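(* For every integer $m\geqslant2$, $$\bigl(r_{\mathcal I}(\mathcal C_m),\,r_{\mathcal D}(\mathcal C_m)\bigr)=(1,m-1).$$ In particular, every pair $(1,d)$ with $d\geqslant1$ a (finite) integer is realized as the rank pair of a variety generated by a finite algebra.
   Context: For $m\geqslant2$, put $X_m=\{0,\ldots,m\}$ and define maps $X_m\to X_m$ by $$\sigma(h)=\max\{h-1,0\},\qquad \tau_j(h)=\begin{cases}0,&h=j,\\ h,&h\ne j,\end{cases}\quad 1\leqslant j\leqslant m.$$ Let $A_m$ be the powerset lattice of $X_m$ with operations $\cup,\cap$ and constants $\varnothing$ (bottom) and $X_m$ (top), expanded by the unary operations $$f(U)=X_m\setminus\sigma^{-1}(U),\qquad e_j(U)=\tau_j^{-1}(U)\quad(1\leqslant j\leqslant m).$$ (Boolean complementation is not a basic operation.) Put $\mathcal C_m=\operatorname{HSP}(A_m)$, the variety generated by $A_m$. The distinguished constant, denoted $0$ in the rank definitions, is the lattice bottom (so it is $\varnothing$ in $A_m$). A semicongruence on an algebra $A$ is a reflexive binary relation on $A$ which is a subalgebra of $A\times A$. For an algebra $A$ with distinguished element $0$ and $I\subseteq A$, let $R_I$ be the least semicongruence containing $I\times\{0\}$, and put $$\mathcal I_0(I)=\{x\in A\mid x\,R_I\,y\text{ for some }y\in I\},\qquad \mathcal D_0(I)=\{x\in A\mid y\,R_I\,x\text{ for some }y\in I\}.$$ Write $\mathcal I_0^n,\mathcal D_0^n$ for the $n$-fold iterates (the relation being regenerated from the current set at every step), with the zeroth iterate the identity operator. For a variety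 $V$ with distinguished constant $0$, the inductive rank $r_{\mathcal I}(V)$ is the least integer $n\ge 0$ such that $\mathcal I_0^n(I)=\mathcal I_0^{n+1}(I)$ for every non-empty subset $I$ of every $A\in V$, and $\infty$ if there is none; the deductive rank $r_{\mathcal D}(V)$ is defined in the same way with $\mathcal D_0$. The rank pair is $(r_{\mathcal I}(V),r_{\mathcal D}(V))$. *)

theory Defs
  imports Main "HOL-Library.FuncSet" "HOL-Library.Extended_Nat"
begin

section \<open>Universal algebra\<close>

text \<open>A signature assigns an arity to each of its operation symbols; symbols mapped to
  \<^const>\<open>None\<close> do not belong to it. Operations take their arguments as a list, and only their
  values on lists of the right length over the carrier matter.\<close>

type_synonym 'f signature = "'f \<Rightarrow> nat option"

record ('f, 'a) alg =
  carrier :: "'a set"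
  oper :: "'f \<Rightarrow> 'a list \<Rightarrow> 'a"

definition closed_under :: "'f signature \<Rightarrow> ('f, 'a) alg \<Rightarrow> 'a set \<Rightarrow> bool" where
  "closed_under \<Sigma> A S \<longleftrightarrow>
     (\<forall>f n xs. \<Sigma> f = Some n \<and> length xs = n \<and> set xs \<subseteq> S \<longrightarrow> oper A f xs \<in> S)"

definition algebra :: "'f signature \<Rightarrow> ('f, 'a) alg \<Rightarrow> bool" where
  "algebra \<Sigma> A \<longleftrightarrow> carrier A \<noteq> {} \<and> closed_under \<Sigma> A (carrier A)"

definition subuniverse :: "'f signature \<Rightarrow> ('f, 'a) alg \<Rightarrow> 'a set \<Rightarrow> bool" where
  "subuniverse \<Sigma> A S \<longleftrightarrow> S \<subseteq> carrier A \<and> closed_under \<Sigma> A S"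

definition hom :: "'f signature \<Rightarrow> ('f, 'a) alg \<Rightarrow> ('f, 'b) alg \<Rightarrow> ('a \<Rightarrow> 'b) set" where
  "hom \<Sigma> A B = {h. h ` carrier A \<subseteq> carrier B \<and>
     (\<forall>f n xs. \<Sigma> f = Some n \<and> length xs = n \<and> set xs \<subseteq> carrier A \<longrightarrow>
        h (oper A f xs) = oper B f (map h xs))}"

definition prod2 :: "('f, 'a) alg \<Rightarrow> ('f, 'b) alg \<Rightarrow> ('f, 'a \<times> 'b) alg" where
  "prod2 A B = \<lparr>carrier = carrier A \<times> carrier B,
     oper = (\<lambda>f xs. (oper A f (map fst xs), oper B f (map snd xs)))\<rparr>"

definition prod_alg :: "'i set \<Rightarrow> ('i \<Rightarrow> ('f, 'a) alg) \<Rightarrow> ('f, 'i \<Rightarrow> 'a) alg" where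
  "prod_alg J A = \<lparr>carrier = (\<Pi>\<^sub>E i\<in>J. carrier (A i)),
     oper = (\<lambda>f xs. \<lambda>i\<in>J. oper (A i) f (map (\<lambda>x. x i) xs))\<rparr>"

text \<open>The class operators of homomorphic images, subalgebras and products. A class of algebras
  is necessarily a set of algebras over one carrier type, so \<open>op_H\<close> collects the homomorphic
  images over an arbitrary carrier type \<open>'b\<close>, and \<open>op_P\<close> the products of families
  indexed by subsets of an arbitrary type \<open>'i\<close>.\<close>

definition op_H :: "'f signature \<Rightarrow> ('f, 'a) alg set \<Rightarrow> ('f, 'b) alg set" where
  "op_H \<Sigma> K = {B. algebra \<Sigma> B \<and> (\<exists>A\<in>K. \<exists>h\<in>hom \<Sigma> A B. h ` carrier A = carrier B)}"

definition op_S :: "'f signature \<Rightarrow> ('f, 'a) alg set \<Rightarrow> ('f, 'a) alg set" where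
  "op_S \<Sigma> K = {A\<lparr>carrier := S\<rparr> | A S. A \<in> K \<and> subuniverse \<Sigma> A S \<and> S \<noteq> {}}"

definition op_P :: "('f, 'a) alg set \<Rightarrow> ('f, 'i \<Rightarrow> 'a) alg set" where
  "op_P K = {prod_alg J A | J A. \<forall>i\<in>J. A i \<in> K}"

text \<open>The algebras over the carrier type \<open>'b\<close> in the variety generated by \<open>K\<close>, obtained
  from products indexed by subsets of \<open>'i\<close>. No generality is lost by this as long as both
  types are left arbitrary: every algebra of the variety then occurs for some \<open>'i\<close> and
  \<open>'b\<close>. But for a finite \<open>'i\<close> or \<open>'b\<close> the class may be too small to contain the
  witnesses for a lower bound on a rank.\<close>

definition HSP :: "'i itself \<Rightarrow> 'f signature \<Rightarrow> ('f, 'a) alg set \<Rightarrow> ('f, 'b) alg set" where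
  "HSP _ \<Sigma> K = op_H \<Sigma> (op_S \<Sigma> (op_P K :: ('f, 'i \<Rightarrow> 'a) alg set))"

section \<open>Semicongruences and ranks\<close>

definition semicongruence :: "'f signature \<Rightarrow> ('f, 'a) alg \<Rightarrow> 'a rel \<Rightarrow> bool" where
  "semicongruence \<Sigma> A R \<longleftrightarrow> Id_on (carrier A) \<subseteq> R \<and> subuniverse \<Sigma> (prod2 A A) R"

text \<open>In what follows, \<open>c\<close> is the symbol of the distinguished constant.\<close>

definition gen_rel :: "'f signature \<Rightarrow> 'f \<Rightarrow> ('f, 'a) alg \<Rightarrow> 'a set \<Rightarrow> 'a rel" where
  "gen_rel \<Sigma> c A I = \<Inter>{R. semicongruence \<Sigma> A R \<and> I \<times> {oper A c []} \<subseteq> R}"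

lemma gen_rel_least:
  fixes A :: "('f, 'a) alg"
  assumes "algebra \<Sigma> A" and "\<Sigma> c = Some 0" and "I \<subseteq> carrier A"
  shows "semicongruence \<Sigma> A (gen_rel \<Sigma> c A I)"
    and "I \<times> {oper A c []} \<subseteq> gen_rel \<Sigma> c A I"
    and "semicongruence \<Sigma> A R \<Longrightarrow> I \<times> {oper A c []} \<subseteq> R \<Longrightarrow> gen_rel \<Sigma> c A I \<subseteq> R"
proof -
  define T where "T = carrier A \<times> carrier A"
  have cl: "closed_under \<Sigma> A (carrier A)"
    using assms(1) by (simp add: algebra_def)
  have "closed_under \<Sigma> (prod2 A A) T"
    unfolding closed_under_def
  proof (intro allI impI, elim conjE)
    fix f n and xs :: "('a \<times> 'a) list"
    assume *: "\<Sigma> f = Some n" "length xs = n" "set xs \<subseteq> T"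
    have "oper A f (map fst xs) \<in> carrier A" "oper A f (map snd xs) \<in> carrier A"
      using cl[unfolded closed_under_def, rule_format, of f n "map fst xs"]
        cl[unfolded closed_under_def, rule_format, of f n "map snd xs"] * by (force simp: T_def)+
    then show "oper (prod2 A A) f xs \<in> T"
      by (simp add: prod2_def T_def)
  qed
  then have T_semi: "semicongruence \<Sigma> A T"
    by (auto simp: semicongruence_def subuniverse_def prod2_def T_def)
  have "oper A c [] \<in> carrier A"
    using cl assms(2) by (simp add: closed_under_def)
  then have IT: "I \<times> {oper A c []} \<subseteq> T"
    using assms(3) by (auto simp: T_def)
  have sub: "gen_rel \<Sigma> c A I \<subseteq> T"
    unfolding gen_rel_def using T_semi IT by blast
  have refl: "Id_on (carrier A) \<subseteq> gen_rel \<Sigma> c A I"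
    unfolding gen_rel_def semicongruence_def by blast
  have "closed_under \<Sigma> (prod2 A A) (gen_rel \<Sigma> c A I)"
    unfolding closed_under_def
  proof (intro allI impI, elim conjE)
    fix f n and xs :: "('a \<times> 'a) list"
    assume *: "\<Sigma> f = Some n" "length xs = n" "set xs \<subseteq> gen_rel \<Sigma> c A I"
    show "oper (prod2 A A) f xs \<in> gen_rel \<Sigma> c A I"
      unfolding gen_rel_def
    proof (rule InterI)
      fix R assume R: "R \<in> {R. semicongruence \<Sigma> A R \<and> I \<times> {oper A c []} \<subseteq> R}"
      then have "set xs \<subseteq> R"
        using *(3) unfolding gen_rel_def by blast
      then show "oper (prod2 A A) f xs \<in> R"
        using R *(1,2) by (simp add: semicongruence_def subuniverse_def closed_under_def)
    qed
  qed
  then show "semicongruence \<Sigma> A (gen_rel \<Sigma> c A I)"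
    using sub refl by (simp add: semicongruence_def subuniverse_def prod2_def T_def)
  show "I \<times> {oper A c []} \<subseteq> gen_rel \<Sigma> c A I"
    unfolding gen_rel_def by blast
  show "gen_rel \<Sigma> c A I \<subseteq> R"
    if "semicongruence \<Sigma> A R" "I \<times> {oper A c []} \<subseteq> R"
    unfolding gen_rel_def using that by blast
qed

definition ind_op :: "'f signature \<Rightarrow> 'f \<Rightarrow> ('f, 'a) alg \<Rightarrow> 'a set \<Rightarrow> 'a set" where
  "ind_op \<Sigma> c A I = {x \<in> carrier A. \<exists>y\<in>I. (x, y) \<in> gen_rel \<Sigma> c A I}"

definition ded_op :: "'f signature \<Rightarrow> 'f \<Rightarrow> ('f, 'a) alg \<Rightarrow> 'a set \<Rightarrow> 'a set" where
  "ded_op \<Sigma> c A I = {x \<in> carrier A. \<exists>y\<in>I. (y, x) \<in> gen_rel \<Sigma> c A I}"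

definition stable_at ::
    "(('f, 'a) alg \<Rightarrow> 'a set \<Rightarrow> 'a set) \<Rightarrow> ('f, 'a) alg set \<Rightarrow> nat \<Rightarrow> bool" where
  "stable_at D V n \<longleftrightarrow>
     (\<forall>A\<in>V. \<forall>I. I \<noteq> {} \<and> I \<subseteq> carrier A \<longrightarrow> (D A ^^ n) I = (D A ^^ (n + 1)) I)"

definition rank :: "(('f, 'a) alg \<Rightarrow> 'a set \<Rightarrow> 'a set) \<Rightarrow> ('f, 'a) alg set \<Rightarrow> enat" where
  "rank D V = (if \<exists>n. stable_at D V n then enat (LEAST n. stable_at D V n) else \<infinity>)"

definition inductive_rank :: "'f signature \<Rightarrow> 'f \<Rightarrow> ('f, 'a) alg set \<Rightarrow> enat" where
  "inductive_rank \<Sigma> c V = rank (ind_op \<Sigma> c) V"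

definition deductive_rank :: "'f signature \<Rightarrow> 'f \<Rightarrow> ('f, 'a) alg set \<Rightarrow> enat" where
  "deductive_rank \<Sigma> c V = rank (ded_op \<Sigma> c) V"

definition rank_pair :: "'f signature \<Rightarrow> 'f \<Rightarrow> ('f, 'a) alg set \<Rightarrow> enat \<times> enat" where
  "rank_pair \<Sigma> c V = (inductive_rank \<Sigma> c V, deductive_rank \<Sigma> c V)"

section \<open>The algebras $A_m$\<close>

definition X_set :: "nat \<Rightarrow> nat set" where
  "X_set m = {0..m}"

text \<open>Subtraction on \<^typ>\<open>nat\<close> is truncated, so this is $\max\{h-1,0\}$.\<close>

definition sigma :: "nat \<Rightarrow> nat" where
  "sigma h = h - 1"

definition tau :: "nat \<Rightarrow> nat \<Rightarrow> nat" where
  "tau j h = (if h = j then 0 else h)"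

datatype opsym = Join | Meet | Bot | Top | F_sym | E_sym nat

fun sig_A :: "nat \<Rightarrow> opsym signature" where
  "sig_A m Join = Some 2"
| "sig_A m Meet = Some 2"
| "sig_A m Bot = Some 0"
| "sig_A m Top = Some 0"
| "sig_A m F_sym = Some 1"
| "sig_A m (E_sym j) = (if 1 \<le> j \<and> j \<le> m then Some 1 else None)"

fun oper_A :: "nat \<Rightarrow> opsym \<Rightarrow> nat set list \<Rightarrow> nat set" where
  "oper_A m Join [U, V] = U \<union> V"
| "oper_A m Meet [U, V] = U \<inter> V"
| "oper_A m Bot [] = {}"
| "oper_A m Top [] = X_set m"
| "oper_A m F_sym [U] = X_set m - {h \<in> X_set m. sigma h \<in> U}"
| "oper_A m (E_sym j) [U] = {h \<in> X_set m. tau j h \<in> U}"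
| "oper_A m _ _ = undefined"

definition alg_A :: "nat \<Rightarrow> (opsym, nat set) alg" where
  "alg_A m = \<lparr>carrier = Pow (X_set m), oper = oper_A m\<rparr>"

lemma algebra_alg_A: "algebra (sig_A m) (alg_A m)"
proof -
  have "oper_A m f xs \<in> Pow (X_set m)"
    if "sig_A m f = Some n" "length xs = n" "set xs \<subseteq> Pow (X_set m)" for f n xs
    using that
    by (cases f)
      (fastforce simp: numeral_2_eq_2 length_Suc_conv Suc_length_conv split: if_splits)+
  then show ?thesis
    unfolding algebra_def closed_under_def alg_A_def by auto
qed

end

theory Submission
  imports Defs
begin

text \<open>
  Every algebra of the variety is a homomorphic image of a ring \<open>C\<close> of subsets of
  \<open>J \<times> X_set m\<close>: a family of subsets of \<open>X_set m\<close> indexed by \<open>J\<close> is the same as one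
  set of pairs \<open>(j, h)\<close>, in which \<open>j\<close> names a column and \<open>h\<close> a level. Only the
  operation \<open>F_set\<close> reverses inclusion. Two classes of elements built from \<open>K\<close> matter, told
  apart by the parity of the number of \<open>F_set\<close> above each generator: the even terms, which
  the generated semicongruence relates to the empty set, and the odd terms, which it relates to
  the full set. They determine the semicongruence: by \<open>gen_rel_ring\<close>, \<open>x\<close> is related to \<open>y\<close> iff
  \<open>x \<subseteq> y \<union> s\<close> and \<open>y \<inter> t \<subseteq> x\<close> for an even term \<open>s\<close> and an odd term \<open>t\<close>. Hence
  \<open>x\<close> lies in $\mathcal I_0(K)$ iff \<open>i \<inter> t \<subseteq> x \<subseteq> s\<close>, and in $\mathcal D_0(K)$ iff
  \<open>x \<inter> t \<subseteq> i\<close>, for some \<open>i \<in> K\<close> and such \<open>s\<close> and \<open>t\<close>.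

  Inductive rank. An element of $\mathcal I_0(K)$ lies below an even term over \<open>K\<close>, so even
  terms over $\mathcal I_0(K)$ lie below even terms over \<open>K\<close>, and odd ones above odd ones:
  nothing new arises in a second step (\<open>ind_op_idem\<close>). The first step is not vacuous,
  because it adds the bottom to the singleton of the top.

  Deductive rank, upper bound. The operations move a point of a column only downwards or to
  level \<open>0\<close>, and an odd term sees a point of level \<open>h > 0\<close> only through points of levels
  below \<open>h\<close>. So one can show by induction on \<open>g\<close> that all iterates from the
  \<open>g\<close>-th on contain the same points of levels up to \<open>g + 1\<close>
  (\<open>iter_agree_on_levels\<close>). The columns in which some element of \<open>K\<close> contains the point
  of level \<open>0\<close> have to be left out, but there some odd term is empty. An element
  is cut off above a level by the operations \<open>E_set\<close>, which send those levels to
  \<open>0\<close>. At \<open>g + 1 = m\<close> nothing is cut off, and this gives stability after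
  \<open>m - 1\<close> steps (\<open>iter_stable\<close>).

  Deductive rank, lower bound. On \<open>m\<close> columns, a ring of upsets of an order that runs zigzag
  between neighbouring columns passes information from one column to the next. Starting from
  a single element, the point \<open>(k, k)\<close> is covered for the first time after \<open>k - 1\<close>
  steps, because it lies below \<open>(k - 1, k)\<close>, which an odd term omits only after
  \<open>(k - 1, k - 1)\<close> has been covered (\<open>diagonal_reached\<close>, \<open>diagonal_not_reached\<close>).
\<close>

section \<open>Generated semicongruences and surjective homomorphisms\<close>

lemma hom_closed:
  assumes "h \<in> hom \<Sigma> B A" "x \<in> carrier B"
  shows "h x \<in> carrier A"
  using assms by (auto simp: hom_def)

lemma hom_oper:
  assumes "h \<in> hom \<Sigma> B A" "\<Sigma> f = Some n" "length xs = n" "set xs \<subseteq> carrier B"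
  shows "h (oper B f xs) = oper A f (map h xs)"
  using assms by (auto simp: hom_def)

lemma closed_underD:
  assumes "closed_under \<Sigma> A S" "\<Sigma> f = Some n" "length xs = n" "set xs \<subseteq> S"
  shows "oper A f xs \<in> S"
  using assms unfolding closed_under_def by blast

text \<open>Images and preimages of semicongruences under \<open>h\<close> are semicongruences. This moves
  all questions about an algebra of the variety to a subalgebra of a power.\<close>

lemma gen_rel_hom_image:
  fixes A :: "('f, 'a) alg" and B :: "('f, 'b) alg"
  assumes A: "algebra \<Sigma> A" and B: "algebra \<Sigma> B" and c: "\<Sigma> c = Some 0"
    and h: "h \<in> hom \<Sigma> B A" and onto: "h ` carrier B = carrier A"
    and I: "I \<subseteq> carrier A"
  shows "gen_rel \<Sigma> c A I = map_prod h h ` gen_rel \<Sigma> c B {x \<in> carrier B. h x \<in> I}"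
proof
  define K where "K = {x \<in> carrier B. h x \<in> I}"
  have K: "K \<subseteq> carrier B" by (auto simp: K_def)
  note RA = gen_rel_least[OF A c I] and RB = gen_rel_least[OF B c K]
  have hc: "h (oper B c []) = oper A c []"
    using hom_oper[OF h c, of "[]"] by simp
  have RBsub: "gen_rel \<Sigma> c B K \<subseteq> carrier B \<times> carrier B"
    using RB(1) by (simp add: semicongruence_def subuniverse_def prod2_def)
  show "gen_rel \<Sigma> c A I \<subseteq> map_prod h h ` gen_rel \<Sigma> c B {x \<in> carrier B. h x \<in> I}"
    unfolding K_def[symmetric]
  proof (rule RA(3))
    show "semicongruence \<Sigma> A (map_prod h h ` gen_rel \<Sigma> c B K)"
      unfolding semicongruence_def subuniverse_def closed_under_def
    proof (intro conjI allI impI; (elim conjE)?)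
      have "Id_on (carrier B) \<subseteq> gen_rel \<Sigma> c B K"
        using RB(1) by (simp add: semicongruence_def)
      then have "map_prod h h ` Id_on (carrier B) \<subseteq> map_prod h h ` gen_rel \<Sigma> c B K"
        by (rule image_mono)
      moreover have "Id_on (carrier A) \<subseteq> map_prod h h ` Id_on (carrier B)"
      proof
        fix p assume "p \<in> Id_on (carrier A)"
        then obtain x where "x \<in> carrier B" "p = map_prod h h (x, x)"
          unfolding onto[symmetric] by auto
        then show "p \<in> map_prod h h ` Id_on (carrier B)"
          by blast
      qed
      ultimately show "Id_on (carrier A) \<subseteq> map_prod h h ` gen_rel \<Sigma> c B K"
        by (rule subset_trans[rotated])
      show "map_prod h h ` gen_rel \<Sigma> c B K \<subseteq> carrier (prod2 A A)"
        using RBsub onto by (auto simp: prod2_def)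
      fix f n and xs :: "('a \<times> 'a) list"
      assume *: "\<Sigma> f = Some n" "length xs = n" "set xs \<subseteq> map_prod h h ` gen_rel \<Sigma> c B K"
      then have "xs \<in> map (map_prod h h) ` lists (gen_rel \<Sigma> c B K)"
        unfolding lists_image[symmetric] in_lists_conv_set by blast
      then obtain ys where ys: "set ys \<subseteq> gen_rel \<Sigma> c B K" "xs = map (map_prod h h) ys"
        by (auto simp: in_lists_conv_set subset_iff)
      have "oper (prod2 B B) f ys \<in> gen_rel \<Sigma> c B K"
        using RB(1) *(1,2) ys by (auto simp: semicongruence_def subuniverse_def intro!: closed_underD)
      moreover have "map_prod h h (oper (prod2 B B) f ys) = oper (prod2 A A) f xs"
      proof -
        have "set (map fst ys) \<subseteq> carrier B" "set (map snd ys) \<subseteq> carrier B"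
          using ys(1) RBsub by auto
        then show ?thesis
          using hom_oper[OF h *(1), of "map fst ys"] hom_oper[OF h *(1), of "map snd ys"] *(2) ys(2)
          by (simp add: prod2_def comp_def)
      qed
      ultimately show "oper (prod2 A A) f xs \<in> map_prod h h ` gen_rel \<Sigma> c B K"
        by (metis image_eqI)
    qed
    have "map_prod h h ` (K \<times> {oper B c []}) \<subseteq> map_prod h h ` gen_rel \<Sigma> c B K"
      using RB(2) by (rule image_mono)
    moreover have "I \<times> {oper A c []} \<subseteq> map_prod h h ` (K \<times> {oper B c []})"
    proof
      fix p assume "p \<in> I \<times> {oper A c []}"
      then obtain i where i: "i \<in> I" "p = (i, oper A c [])" by blast
      then obtain x where "x \<in> carrier B" "h x = i" using I onto by (metis imageE subsetD)
      with i hc have "p = map_prod h h (x, oper B c [])" "x \<in> K"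
        by (simp_all add: K_def)
      then show "p \<in> map_prod h h ` (K \<times> {oper B c []})"
        by blast
    qed
    ultimately show "I \<times> {oper A c []} \<subseteq> map_prod h h ` gen_rel \<Sigma> c B K"
      by (rule subset_trans[rotated])
  qed
  define R where "R = {(x, y). x \<in> carrier B \<and> y \<in> carrier B \<and> (h x, h y) \<in> gen_rel \<Sigma> c A I}"
  have "gen_rel \<Sigma> c B K \<subseteq> R"
  proof (rule RB(3))
    show "semicongruence \<Sigma> B R"
      unfolding semicongruence_def subuniverse_def closed_under_def
    proof (intro conjI allI impI; (elim conjE)?)
      show "Id_on (carrier B) \<subseteq> R"
        using RA(1) hom_closed[OF h] by (auto simp: R_def semicongruence_def)
      show "R \<subseteq> carrier (prod2 B B)"
        by (auto simp: R_def prod2_def)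
      fix f n and xs :: "('b \<times> 'b) list"
      assume *: "\<Sigma> f = Some n" "length xs = n" "set xs \<subseteq> R"
      have xs: "set (map fst xs) \<subseteq> carrier B" "set (map snd xs) \<subseteq> carrier B"
        using *(3) by (auto simp: R_def)
      have "set (map (map_prod h h) xs) \<subseteq> gen_rel \<Sigma> c A I"
        using *(3) by (auto simp: R_def)
      then have "oper (prod2 A A) f (map (map_prod h h) xs) \<in> gen_rel \<Sigma> c A I"
        using RA(1) *(1,2) by (auto simp: semicongruence_def subuniverse_def intro!: closed_underD)
      moreover have "oper B f (map fst xs) \<in> carrier B" "oper B f (map snd xs) \<in> carrier B"
        using B *(1,2) xs unfolding algebra_def by (auto intro!: closed_underD[where n = n])
      ultimately show "oper (prod2 B B) f xs \<in> R"
        using hom_oper[OF h *(1), of "map fst xs"] hom_oper[OF h *(1), of "map snd xs"] *(2) xs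
        by (simp add: R_def prod2_def comp_def)
    qed
    have "oper B c [] \<in> carrier B"
      using B c by (auto simp: algebra_def intro!: closed_underD)
    then show "K \<times> {oper B c []} \<subseteq> R"
      using RA(2) hc by (auto simp: R_def K_def)
  qed
  then show "map_prod h h ` gen_rel \<Sigma> c B {x \<in> carrier B. h x \<in> I} \<subseteq> gen_rel \<Sigma> c A I"
    unfolding K_def[symmetric] by (auto simp: R_def)
qed

section \<open>Rings of sets\<close>

text \<open>The operations of a power of $A_m$, read on the sets of pairs \<open>(j, h)\<close> that correspond
  to its elements.\<close>

definition F_set :: "'j set \<Rightarrow> nat \<Rightarrow> ('j \<times> nat) set \<Rightarrow> ('j \<times> nat) set" where
  "F_set J m U = {(j, h) \<in> J \<times> X_set m. (j, sigma h) \<notin> U}"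

definition E_set :: "'j set \<Rightarrow> nat \<Rightarrow> nat \<Rightarrow> ('j \<times> nat) set \<Rightarrow> ('j \<times> nat) set" where
  "E_set J m k U = {(j, h) \<in> J \<times> X_set m. (j, tau k h) \<in> U}"

fun set_oper :: "'j set \<Rightarrow> nat \<Rightarrow> opsym \<Rightarrow> ('j \<times> nat) set list \<Rightarrow> ('j \<times> nat) set" where
  "set_oper J m Join [U, V] = U \<union> V"
| "set_oper J m Meet [U, V] = U \<inter> V"
| "set_oper J m Bot [] = {}"
| "set_oper J m Top [] = J \<times> X_set m"
| "set_oper J m F_sym [U] = F_set J m U"
| "set_oper J m (E_sym k) [U] = E_set J m k U"
| "set_oper J m _ _ = undefined"

definition ring_alg :: "'j set \<Rightarrow> nat \<Rightarrow> ('j \<times> nat) set set \<Rightarrow> (opsym, ('j \<times> nat) set) alg" where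
  "ring_alg J m C = \<lparr>carrier = C, oper = set_oper J m\<rparr>"

lemma ring_alg_simps [simp]:
  "carrier (ring_alg J m C) = C" "oper (ring_alg J m C) = set_oper J m"
  by (simp_all add: ring_alg_def)

locale set_ring =
  fixes J :: "'j set" and m :: nat and C :: "('j \<times> nat) set set"
  assumes sub: "C \<subseteq> Pow (J \<times> X_set m)"
    and empty_mem [simp]: "{} \<in> C"
    and top_mem [simp]: "J \<times> X_set m \<in> C"
    and Un_mem [simp]: "U \<in> C \<Longrightarrow> V \<in> C \<Longrightarrow> U \<union> V \<in> C"
    and Int_mem [simp]: "U \<in> C \<Longrightarrow> V \<in> C \<Longrightarrow> U \<inter> V \<in> C"
    and F_mem [simp]: "U \<in> C \<Longrightarrow> F_set J m U \<in> C"
    and E_mem [simp]: "U \<in> C \<Longrightarrow> 1 \<le> k \<Longrightarrow> k \<le> m \<Longrightarrow> E_set J m k U \<in> C"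

lemma sig_A_cases:
  assumes "sig_A m f = Some n" "length xs = n"
  obtains (Join) U V where "f = Join" "n = 2" "xs = [U, V]"
    | (Meet) U V where "f = Meet" "n = 2" "xs = [U, V]"
    | (Bot) "f = Bot" "n = 0" "xs = []"
    | (Top) "f = Top" "n = 0" "xs = []"
    | (F) U where "f = F_sym" "n = 1" "xs = [U]"
    | (E) k U where "f = E_sym k" "n = 1" "1 \<le> k" "k \<le> m" "xs = [U]"
  using assms
  by (cases f) (auto simp: numeral_2_eq_2 length_Suc_conv Suc_length_conv split: if_splits)

lemma closed_under_iff:
  "closed_under (sig_A m) A S \<longleftrightarrow>
     oper A Bot [] \<in> S \<and> oper A Top [] \<in> S \<and>
     (\<forall>x\<in>S. \<forall>y\<in>S. oper A Join [x, y] \<in> S \<and> oper A Meet [x, y] \<in> S) \<and>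
     (\<forall>x\<in>S. oper A F_sym [x] \<in> S) \<and>
     (\<forall>x\<in>S. \<forall>k. 1 \<le> k \<and> k \<le> m \<longrightarrow> oper A (E_sym k) [x] \<in> S)" (is "?l = ?r")
proof
  assume l: ?l
  have *: "oper A f xs \<in> S" if "sig_A m f = Some (length xs)" "set xs \<subseteq> S" for f xs
    using l that unfolding closed_under_def by blast
  show ?r
    using *[of Bot "[]"] *[of Top "[]"] *[of Join "[_, _]"] *[of Meet "[_, _]"]
      *[of F_sym "[_]"] *[of "E_sym _" "[_]"]
    by auto
next
  assume r: ?r
  show ?l
    unfolding closed_under_def
  proof (intro allI impI, elim conjE)
    fix f n xs assume "sig_A m f = Some n" "length xs = n" "set xs \<subseteq> S"
    then show "oper A f xs \<in> S"
      using r by (cases rule: sig_A_cases) auto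
  qed
qed

lemma set_ring_iff:
  "set_ring J m C \<longleftrightarrow> C \<subseteq> Pow (J \<times> X_set m) \<and> closed_under (sig_A m) (ring_alg J m C) C"
  unfolding set_ring_def closed_under_iff by auto

text \<open>The closure of \<open>K\<close> under the operations, graded by the parity of the number of \<open>F_set\<close>
  above a generator. Odd terms are closed under \<open>\<inter>\<close> and even ones under \<open>\<union>\<close> only, which
  is what the criterion for generated semicongruences requires.\<close>

inductive_set even_terms and odd_terms
  for J :: "'j set" and m :: nat and K :: "('j \<times> nat) set set"
  where
    even_gen: "x \<in> K \<Longrightarrow> x \<in> even_terms J m K"
  | even_bot: "{} \<in> even_terms J m K"
  | even_Un: "x \<in> even_terms J m K \<Longrightarrow> y \<in> even_terms J m K \<Longrightarrow> x \<union> y \<in> even_terms J m K"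
  | even_E: "x \<in> even_terms J m K \<Longrightarrow> 1 \<le> k \<Longrightarrow> k \<le> m \<Longrightarrow> E_set J m k x \<in> even_terms J m K"
  | even_F: "x \<in> odd_terms J m K \<Longrightarrow> F_set J m x \<in> even_terms J m K"
  | odd_top: "J \<times> X_set m \<in> odd_terms J m K"
  | odd_Int: "x \<in> odd_terms J m K \<Longrightarrow> y \<in> odd_terms J m K \<Longrightarrow> x \<inter> y \<in> odd_terms J m K"
  | odd_E: "x \<in> odd_terms J m K \<Longrightarrow> 1 \<le> k \<Longrightarrow> k \<le> m \<Longrightarrow> E_set J m k x \<in> odd_terms J m K"
  | odd_F: "x \<in> even_terms J m K \<Longrightarrow> F_set J m x \<in> odd_terms J m K"

lemma sigma_mem [simp]: "h \<in> X_set m \<Longrightarrow> sigma h \<in> X_set m"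
  by (auto simp: X_set_def sigma_def)

lemma tau_mem [simp]: "h \<in> X_set m \<Longrightarrow> tau k h \<in> X_set m"
  by (auto simp: X_set_def tau_def)

lemma F_set_mem: "(j, h) \<in> F_set J m U \<longleftrightarrow> j \<in> J \<and> h \<in> X_set m \<and> (j, sigma h) \<notin> U"
  by (simp add: F_set_def)

lemma E_set_mem: "(j, h) \<in> E_set J m k U \<longleftrightarrow> j \<in> J \<and> h \<in> X_set m \<and> (j, tau k h) \<in> U"
  by (simp add: E_set_def)

lemma F_empty: "F_set J m {} = J \<times> X_set m"
  and F_top: "F_set J m (J \<times> X_set m) = {}"
  and E_empty: "E_set J m k {} = {}"
  and E_top: "E_set J m k (J \<times> X_set m) = J \<times> X_set m"
  by (auto simp: F_set_mem E_set_mem)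

lemma F_Un: "F_set J m (U \<union> V) = F_set J m U \<inter> F_set J m V"
  and F_Int: "F_set J m (U \<inter> V) = F_set J m U \<union> F_set J m V"
  and E_Un: "E_set J m k (U \<union> V) = E_set J m k U \<union> E_set J m k V"
  and E_Int: "E_set J m k (U \<inter> V) = E_set J m k U \<inter> E_set J m k V"
  by (auto simp: F_set_mem E_set_mem)

lemma F_anti: "U \<subseteq> V \<Longrightarrow> F_set J m V \<subseteq> F_set J m U"
  and E_mono: "U \<subseteq> V \<Longrightarrow> E_set J m k U \<subseteq> E_set J m k V"
  by (auto simp: F_set_mem E_set_mem)

lemma terms_mono:
  assumes "K \<subseteq> L"
  shows "even_terms J m K \<subseteq> even_terms J m L" and "odd_terms J m K \<subseteq> odd_terms J m L"
proof -
  have "(x \<in> even_terms J m K \<longrightarrow> x \<in> even_terms J m L) \<and>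
        (y \<in> odd_terms J m K \<longrightarrow> y \<in> odd_terms J m L)" for x y
  proof (rule even_terms_odd_terms.induct)
  qed (use assms in \<open>auto intro: even_terms_odd_terms.intros\<close>)
  then show "even_terms J m K \<subseteq> even_terms J m L" "odd_terms J m K \<subseteq> odd_terms J m L"
    by blast+
qed

context set_ring
begin

lemma algebra_ring: "algebra (sig_A m) (ring_alg J m C)"
  using set_ring_axioms empty_mem unfolding algebra_def set_ring_iff ring_alg_simps by blast

lemma oper_mem:
  assumes "sig_A m f = Some n" "length us = n" "set us \<subseteq> C"
  shows "set_oper J m f us \<in> C"
  using closed_underD[of "sig_A m" "ring_alg J m C" C, OF _ assms] algebra_ring
  by (simp add: algebra_def)

lemma terms_mem:
  assumes "K \<subseteq> C"
  shows "even_terms J m K \<subseteq> C" and "odd_terms J m K \<subseteq> C"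
proof -
  have "(x \<in> even_terms J m K \<longrightarrow> x \<in> C) \<and> (y \<in> odd_terms J m K \<longrightarrow> y \<in> C)" for x y
  proof (rule even_terms_odd_terms.induct)
  qed (use assms in auto)
  then show "even_terms J m K \<subseteq> C" "odd_terms J m K \<subseteq> C"
    by blast+
qed

lemma prod2_closed_iff:
  "closed_under (sig_A m) (prod2 (ring_alg J m C) (ring_alg J m C)) R \<longleftrightarrow>
     ({}, {}) \<in> R \<and> (J \<times> X_set m, J \<times> X_set m) \<in> R \<and>
     (\<forall>x y x' y'. (x, y) \<in> R \<and> (x', y') \<in> R \<longrightarrow>
       (x \<union> x', y \<union> y') \<in> R \<and> (x \<inter> x', y \<inter> y') \<in> R) \<and>
     (\<forall>x y. (x, y) \<in> R \<longrightarrow> (F_set J m x, F_set J m y) \<in> R) \<and>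
     (\<forall>x y k. (x, y) \<in> R \<and> 1 \<le> k \<and> k \<le> m \<longrightarrow> (E_set J m k x, E_set J m k y) \<in> R)"
  unfolding closed_under_iff by (simp add: prod2_def Ball_def split_paired_All) blast

text \<open>The relation on the right is closed under the operations because \<open>F_set\<close> exchanges the
  two inclusions and the two kinds of terms. Conversely, every semicongruence that relates
  \<open>K\<close> to \<open>{}\<close> relates even terms to \<open>{}\<close> and odd terms to the full set, and
  then \<open>x = (x \<inter> y) \<union> (x \<inter> s)\<close> to \<open>x \<inter> y\<close>, and \<open>y \<inter> t\<close> to \<open>y\<close>;
  the join of these two pairs is \<open>(x, y)\<close>.\<close>

lemma gen_rel_ring:
  assumes K: "K \<subseteq> C"
  shows "gen_rel (sig_A m) Bot (ring_alg J m C) K =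
    {(x, y). x \<in> C \<and> y \<in> C \<and>
      (\<exists>s\<in>even_terms J m K. x \<subseteq> y \<union> s) \<and> (\<exists>t\<in>odd_terms J m K. y \<inter> t \<subseteq> x)}" (is "_ = ?Q")
proof
  let ?A = "ring_alg J m C"
  have least: "semicongruence (sig_A m) ?A (gen_rel (sig_A m) Bot ?A K)"
    "K \<times> {{}} \<subseteq> gen_rel (sig_A m) Bot ?A K"
    "\<And>R. semicongruence (sig_A m) ?A R \<Longrightarrow> K \<times> {{}} \<subseteq> R \<Longrightarrow> gen_rel (sig_A m) Bot ?A K \<subseteq> R"
    using gen_rel_least[OF algebra_ring, of Bot K] K by simp_all
  show "gen_rel (sig_A m) Bot ?A K \<subseteq> ?Q"
  proof (rule least(3))
    have QI: "(x, y) \<in> ?Q" if "x \<in> C" "y \<in> C" "s \<in> even_terms J m K" "x \<subseteq> y \<union> s"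
      "t \<in> odd_terms J m K" "y \<inter> t \<subseteq> x" for x y s t
      using that by blast
    have refl: "(x, x) \<in> ?Q" if "x \<in> C" for x
      using that by (intro QI[OF _ _ even_bot _ odd_top]) auto
    have "closed_under (sig_A m) (prod2 ?A ?A) ?Q"
      unfolding prod2_closed_iff
    proof (intro conjI allI impI; (elim conjE)?)
      show "({}, {}) \<in> ?Q" "(J \<times> X_set m, J \<times> X_set m) \<in> ?Q"
        by (simp_all only: refl empty_mem top_mem)
    next
      fix x y x' y' assume "(x, y) \<in> ?Q" "(x', y') \<in> ?Q"
      then obtain s t s' t' where *: "x \<in> C" "y \<in> C" "s \<in> even_terms J m K" "x \<subseteq> y \<union> s"
        "t \<in> odd_terms J m K" "y \<inter> t \<subseteq> x"
        "x' \<in> C" "y' \<in> C" "s' \<in> even_terms J m K" "x' \<subseteq> y' \<union> s'"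
        "t' \<in> odd_terms J m K" "y' \<inter> t' \<subseteq> x'"
        by blast
      have st: "s \<union> s' \<in> even_terms J m K" "t \<inter> t' \<in> odd_terms J m K"
        using * by (simp_all add: even_Un odd_Int)
      have "x \<union> x' \<subseteq> (y \<union> y') \<union> (s \<union> s')" "(y \<union> y') \<inter> (t \<inter> t') \<subseteq> x \<union> x'"
        using * by blast+
      then show "(x \<union> x', y \<union> y') \<in> ?Q"
        using * st by (intro QI Un_mem)
      have "x \<inter> x' \<subseteq> (y \<inter> y') \<union> (s \<union> s')" "(y \<inter> y') \<inter> (t \<inter> t') \<subseteq> x \<inter> x'"
        using * by blast+
      then show "(x \<inter> x', y \<inter> y') \<in> ?Q"
        using * st by (intro QI Int_mem)
    next
      fix x y assume "(x, y) \<in> ?Q"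
      then obtain s t where *: "x \<in> C" "y \<in> C" "s \<in> even_terms J m K" "x \<subseteq> y \<union> s"
        "t \<in> odd_terms J m K" "y \<inter> t \<subseteq> x"
        by blast
      have "F_set J m x \<subseteq> F_set J m y \<union> F_set J m t" "F_set J m y \<inter> F_set J m s \<subseteq> F_set J m x"
        using F_anti[OF *(4)] F_anti[OF *(6)] by (auto simp: F_Un F_Int)
      then show "(F_set J m x, F_set J m y) \<in> ?Q"
        using * by (intro QI[where s = "F_set J m t" and t = "F_set J m s"] F_mem even_F odd_F)
    next
      fix x y k assume "(x, y) \<in> ?Q" and k: "1 \<le> k" "k \<le> m"
      then obtain s t where *: "x \<in> C" "y \<in> C" "s \<in> even_terms J m K" "x \<subseteq> y \<union> s"
        "t \<in> odd_terms J m K" "y \<inter> t \<subseteq> x"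
        by blast
      have "E_set J m k x \<subseteq> E_set J m k y \<union> E_set J m k s"
        "E_set J m k y \<inter> E_set J m k t \<subseteq> E_set J m k x"
        using E_mono[OF *(4)] E_mono[OF *(6)] by (simp_all add: E_Un E_Int)
      then show "(E_set J m k x, E_set J m k y) \<in> ?Q"
        using * k by (intro QI[where s = "E_set J m k s" and t = "E_set J m k t"] E_mem even_E odd_E)
    qed
    then show "semicongruence (sig_A m) ?A ?Q"
      using refl unfolding semicongruence_def subuniverse_def by (simp add: prod2_def) blast
    show "K \<times> {{}} \<subseteq> ?Q"
    proof
      fix p :: "('j \<times> nat) set \<times> ('j \<times> nat) set" assume "p \<in> K \<times> {{}}"
      then obtain x where "x \<in> K" "p = (x, {})" by blast
      moreover from this have "(x, {}) \<in> ?Q"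
        using K by (intro QI[OF _ _ even_gen _ odd_top]) auto
      ultimately show "p \<in> ?Q" by simp
    qed
  qed
  let ?R = "gen_rel (sig_A m) Bot ?A K"
  have refl: "(x, x) \<in> ?R" if "x \<in> C" for x
    using least(1) that by (auto simp: semicongruence_def)
  have cl: "closed_under (sig_A m) (prod2 ?A ?A) ?R"
    using least(1) by (simp add: semicongruence_def subuniverse_def)
  have Un: "(x \<union> x', y \<union> y') \<in> ?R" and Int: "(x \<inter> x', y \<inter> y') \<in> ?R"
    if "(x, y) \<in> ?R" "(x', y') \<in> ?R" for x y x' y'
    using cl that unfolding prod2_closed_iff by blast+
  have F: "(F_set J m x, F_set J m y) \<in> ?R" if "(x, y) \<in> ?R" for x y
    using cl that unfolding prod2_closed_iff by blast
  have E: "(E_set J m k x, E_set J m k y) \<in> ?R" if "(x, y) \<in> ?R" "1 \<le> k" "k \<le> m" for x y k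
    using cl that unfolding prod2_closed_iff by blast
  have "(s \<in> even_terms J m K \<longrightarrow> (s, {}) \<in> ?R) \<and> (t \<in> odd_terms J m K \<longrightarrow> (t, J \<times> X_set m) \<in> ?R)" for s t
  proof (rule even_terms_odd_terms.induct)
    show "(x, {}) \<in> ?R" if "x \<in> K" for x
      using that least(2) by blast
    show "(E_set J m k x, {}) \<in> ?R" if "(x, {}) \<in> ?R" "1 \<le> k" "k \<le> m" for k x
      using E[OF that] by (simp add: E_empty)
    show "(E_set J m k x, J \<times> X_set m) \<in> ?R" if "(x, J \<times> X_set m) \<in> ?R" "1 \<le> k" "k \<le> m" for k x
      using E[OF that] by (simp add: E_top)
    show "(F_set J m x, {}) \<in> ?R" if "(x, J \<times> X_set m) \<in> ?R" for x
      using F[OF that] by (simp add: F_top)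
    show "(F_set J m x, J \<times> X_set m) \<in> ?R" if "(x, {}) \<in> ?R" for x
      using F[OF that] by (simp add: F_empty)
    show "(x \<union> y, {}) \<in> ?R" if "(x, {}) \<in> ?R" "(y, {}) \<in> ?R" for x y
      using Un[OF that] by simp
    show "(x \<inter> y, J \<times> X_set m) \<in> ?R" if "(x, J \<times> X_set m) \<in> ?R" "(y, J \<times> X_set m) \<in> ?R" for x y
      using Int[OF that] by simp
  qed (use refl in auto)
  then have s: "s \<in> even_terms J m K \<Longrightarrow> (s, {}) \<in> ?R" and t: "t \<in> odd_terms J m K \<Longrightarrow> (t, J \<times> X_set m) \<in> ?R" for s t
    by blast+
  show "?Q \<subseteq> ?R"
  proof
    fix p assume "p \<in> ?Q"
    then obtain x y s t where p: "p = (x, y)"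
      and *: "x \<in> C" "y \<in> C" "s \<in> even_terms J m K" "x \<subseteq> y \<union> s"
        "t \<in> odd_terms J m K" "y \<inter> t \<subseteq> x"
      by blast
    have "((x \<inter> y) \<union> (x \<inter> s), (x \<inter> y) \<union> (x \<inter> {})) \<in> ?R"
      using * by (intro Un Int refl s)
    moreover have "(y \<inter> t, y \<inter> (J \<times> X_set m)) \<in> ?R"
      using * by (intro Int refl t)
    moreover have "(x \<inter> y) \<union> (x \<inter> s) = x" "(x \<inter> y) \<union> (x \<inter> {}) = x \<inter> y" "y \<inter> (J \<times> X_set m) = y"
      using * sub by blast+
    ultimately have "(x \<union> (y \<inter> t), (x \<inter> y) \<union> y) \<in> ?R"
      using Un[of x "x \<inter> y" "y \<inter> t" y] by simp
    moreover have "x \<union> (y \<inter> t) = x" "(x \<inter> y) \<union> y = y"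
      using * by blast+
    ultimately show "p \<in> ?R" using p by simp
  qed
qed

lemma ded_op_ring:
  assumes K: "K \<subseteq> C"
  shows "ded_op (sig_A m) Bot (ring_alg J m C) K =
    {x \<in> C. \<exists>i\<in>K. \<exists>t\<in>odd_terms J m K. x \<inter> t \<subseteq> i}"
proof -
  have "i \<subseteq> x \<union> i \<and> i \<in> even_terms J m K \<and> i \<in> C" if "i \<in> K" for i x
    using that K even_gen by blast
  then show ?thesis
    unfolding ded_op_def gen_rel_ring[OF K] by (simp, blast)
qed

lemma ind_op_ring:
  assumes K: "K \<subseteq> C"
  shows "ind_op (sig_A m) Bot (ring_alg J m C) K =
    {x \<in> C. (\<exists>s\<in>even_terms J m K. x \<subseteq> s) \<and> (\<exists>i\<in>K. \<exists>t\<in>odd_terms J m K. i \<inter> t \<subseteq> x)}"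
    (is "_ = ?Q")
proof (intro set_eqI iffI)
  fix x assume "x \<in> ind_op (sig_A m) Bot (ring_alg J m C) K"
  then obtain i s t where *: "x \<in> C" "i \<in> K" "s \<in> even_terms J m K" "x \<subseteq> i \<union> s"
    "t \<in> odd_terms J m K" "i \<inter> t \<subseteq> x"
    unfolding ind_op_def gen_rel_ring[OF K] by auto
  then show "x \<in> ?Q"
    using even_Un[OF even_gen[OF *(2)] *(3)] by blast
next
  fix x assume "x \<in> ?Q"
  then obtain i s t where *: "x \<in> C" "i \<in> K" "s \<in> even_terms J m K" "x \<subseteq> s"
    "t \<in> odd_terms J m K" "i \<inter> t \<subseteq> x"
    by blast
  then have "i \<in> C" "x \<subseteq> i \<union> s"
    using K by blast+
  then show "x \<in> ind_op (sig_A m) Bot (ring_alg J m C) K"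
    unfolding ind_op_def gen_rel_ring[OF K] using * by auto
qed

end


section \<open>Homomorphic images of rings of sets\<close>

locale ring_image = set_ring J m C
  for J :: "'j set" and m :: nat and C :: "('j \<times> nat) set set" +
  fixes A :: "(opsym, 'a) alg" and h :: "('j \<times> nat) set \<Rightarrow> 'a"
  assumes algebra_image: "algebra (sig_A m) A"
    and h_hom: "h \<in> hom (sig_A m) (ring_alg J m C) A"
    and h_onto: "h ` C = carrier A"
begin

definition pullback :: "'a set \<Rightarrow> ('j \<times> nat) set set" where
  "pullback I = {x \<in> C. h x \<in> I}"

lemma pullback_sub: "pullback I \<subseteq> C"
  by (auto simp: pullback_def)

lemma image_pullback: "I \<subseteq> carrier A \<Longrightarrow> h ` pullback I = I"
  unfolding pullback_def h_onto[symmetric] by blast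

lemma h_Un: "x \<in> C \<Longrightarrow> y \<in> C \<Longrightarrow> h (x \<union> y) = oper A Join [h x, h y]"
  and h_Int: "x \<in> C \<Longrightarrow> y \<in> C \<Longrightarrow> h (x \<inter> y) = oper A Meet [h x, h y]"
  and h_F: "x \<in> C \<Longrightarrow> h (F_set J m x) = oper A F_sym [h x]"
  and h_E: "x \<in> C \<Longrightarrow> 1 \<le> k \<Longrightarrow> k \<le> m \<Longrightarrow> h (E_set J m k x) = oper A (E_sym k) [h x]"
  using hom_oper[OF h_hom, of Join 2 "[x, y]"] hom_oper[OF h_hom, of Meet 2 "[x, y]"]
    hom_oper[OF h_hom, of F_sym 1 "[x]"] hom_oper[OF h_hom, of "E_sym k" 1 "[x]"]
  by auto

lemma gen_rel_image:
  assumes "I \<subseteq> carrier A"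
  shows "gen_rel (sig_A m) Bot A I =
    map_prod h h ` gen_rel (sig_A m) Bot (ring_alg J m C) (pullback I)"
  using gen_rel_hom_image[OF algebra_image algebra_ring _ h_hom _ assms, of Bot] h_onto
  by (simp add: pullback_def)

lemma gen_rel_sub:
  assumes "K \<subseteq> C"
  shows "gen_rel (sig_A m) Bot (ring_alg J m C) K \<subseteq> C \<times> C"
  unfolding gen_rel_ring[OF assms] by blast

lemma ind_op_image:
  assumes I: "I \<subseteq> carrier A"
  shows "ind_op (sig_A m) Bot A I = h ` ind_op (sig_A m) Bot (ring_alg J m C) (pullback I)"
proof (intro set_eqI iffI)
  fix a assume "a \<in> ind_op (sig_A m) Bot A I"
  then obtain b where "b \<in> I" "(a, b) \<in> gen_rel (sig_A m) Bot A I"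
    by (auto simp: ind_op_def)
  then obtain x y where "(x, y) \<in> gen_rel (sig_A m) Bot (ring_alg J m C) (pullback I)"
    "a = h x" "b = h y"
    unfolding gen_rel_image[OF I] by auto
  then show "a \<in> h ` ind_op (sig_A m) Bot (ring_alg J m C) (pullback I)"
    using gen_rel_sub[OF pullback_sub] \<open>b \<in> I\<close> by (auto simp: ind_op_def pullback_def)
next
  fix a assume "a \<in> h ` ind_op (sig_A m) Bot (ring_alg J m C) (pullback I)"
  then obtain x y where *: "a = h x" "x \<in> C" "y \<in> pullback I"
    "(x, y) \<in> gen_rel (sig_A m) Bot (ring_alg J m C) (pullback I)"
    by (auto simp: ind_op_def)
  then have "(h x, h y) \<in> gen_rel (sig_A m) Bot A I"
    unfolding gen_rel_image[OF I] by (metis image_eqI map_prod_simp)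
  then show "a \<in> ind_op (sig_A m) Bot A I"
    using * h_onto by (auto simp: ind_op_def pullback_def)
qed

text \<open>Preimages of deductively generated sets need no correction by the kernel of \<open>h\<close>: if
  \<open>h x = h x'\<close> and \<open>x' \<inter> t \<subseteq> y\<close>, then \<open>y \<union> (x \<inter> t)\<close> has the same image as
  \<open>y\<close> and lies above \<open>x \<inter> t\<close>. This lets the operator be iterated inside the ring.\<close>

lemma pullback_ded_op:
  assumes I: "I \<subseteq> carrier A"
  shows "pullback (ded_op (sig_A m) Bot A I) =
    ded_op (sig_A m) Bot (ring_alg J m C) (pullback I)"
proof (intro set_eqI iffI)
  fix x assume "x \<in> pullback (ded_op (sig_A m) Bot A I)"
  then obtain b where x: "x \<in> C" and b: "b \<in> I" "(b, h x) \<in> gen_rel (sig_A m) Bot A I"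
    by (auto simp: ded_op_def pullback_def)
  then obtain y x' where yx: "(y, x') \<in> gen_rel (sig_A m) Bot (ring_alg J m C) (pullback I)"
    "b = h y" "h x = h x'"
    unfolding gen_rel_image[OF I] by auto
  then obtain t where t: "y \<in> C" "x' \<in> C" "t \<in> odd_terms J m (pullback I)" "x' \<inter> t \<subseteq> y"
    unfolding gen_rel_ring[OF pullback_sub] by auto
  have tC: "t \<in> C"
    using t(3) terms_mem(2)[OF pullback_sub] by blast
  have "h (y \<union> (x \<inter> t)) = h (y \<union> (x' \<inter> t))"
    using x t tC yx(3) by (simp add: h_Un h_Int)
  also have "y \<union> (x' \<inter> t) = y"
    using t(4) by blast
  finally have "y \<union> (x \<inter> t) \<in> pullback I"
    using x t tC yx(2) b(1) by (simp add: pullback_def)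
  then show "x \<in> ded_op (sig_A m) Bot (ring_alg J m C) (pullback I)"
    unfolding ded_op_ring[OF pullback_sub] using x t(3) by blast
next
  fix x assume "x \<in> ded_op (sig_A m) Bot (ring_alg J m C) (pullback I)"
  then obtain y where *: "x \<in> C" "y \<in> pullback I"
    "(y, x) \<in> gen_rel (sig_A m) Bot (ring_alg J m C) (pullback I)"
    by (auto simp: ded_op_def)
  then have "(h y, h x) \<in> gen_rel (sig_A m) Bot A I"
    unfolding gen_rel_image[OF I] by (metis image_eqI map_prod_simp)
  then show "x \<in> pullback (ded_op (sig_A m) Bot A I)"
    using * h_onto by (auto simp: ded_op_def pullback_def)
qed

lemma ded_iter_sub:
  "I \<subseteq> carrier A \<Longrightarrow> (ded_op (sig_A m) Bot A ^^ n) I \<subseteq> carrier A"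
  by (induction n) (auto simp: ded_op_def)

lemma pullback_ded_iter:
  "I \<subseteq> carrier A \<Longrightarrow> pullback ((ded_op (sig_A m) Bot A ^^ n) I) =
     (ded_op (sig_A m) Bot (ring_alg J m C) ^^ n) (pullback I)"
  by (induction n) (simp_all add: pullback_ded_op ded_iter_sub)

lemma ded_iter_image:
  assumes "I \<subseteq> carrier A"
  shows "(ded_op (sig_A m) Bot A ^^ n) I =
    h ` (ded_op (sig_A m) Bot (ring_alg J m C) ^^ n) (pullback I)"
  using image_pullback[OF ded_iter_sub[OF assms]] pullback_ded_iter[OF assms] by metis

section \<open>The inductive operator is idempotent\<close>

text \<open>Unlike for the deductive operator, the preimage \<open>L\<close> of an inductively generated set
  consists of the elements equivalent, modulo the kernel of \<open>h\<close>, to elements generated in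
  the ring. So terms over \<open>L\<close> are compared with terms over \<open>K\<close> only after
  replacing them by equivalent elements \<open>s0\<close> and \<open>t0\<close>.\<close>

lemma terms_of_pullback_ind_op:
  fixes I :: "'a set"
  assumes I: "I \<subseteq> carrier A"
  defines "K \<equiv> pullback I" and "L \<equiv> pullback (ind_op (sig_A m) Bot A I)"
  shows "s \<in> even_terms J m L \<Longrightarrow>
      \<exists>s0\<in>C. h s0 = h s \<and> (\<exists>s1\<in>even_terms J m K. s0 \<subseteq> s1)"
    and "t \<in> odd_terms J m L \<Longrightarrow>
      \<exists>t0\<in>C. h t0 = h t \<and> (\<exists>t1\<in>odd_terms J m K. t1 \<subseteq> t0)"
proof -
  let ?P = "\<lambda>s. s \<in> C \<and> (\<exists>s0\<in>C. h s0 = h s \<and> (\<exists>s1\<in>even_terms J m K. s0 \<subseteq> s1))"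
  let ?Q = "\<lambda>t. t \<in> C \<and> (\<exists>t0\<in>C. h t0 = h t \<and> (\<exists>t1\<in>odd_terms J m K. t1 \<subseteq> t0))"
  have PI: "?P s" if "s \<in> C" "s0 \<in> C" "h s0 = h s" "s1 \<in> even_terms J m K" "s0 \<subseteq> s1" for s s0 s1
    using that by blast
  have QI: "?Q t" if "t \<in> C" "t0 \<in> C" "h t0 = h t" "t1 \<in> odd_terms J m K" "t1 \<subseteq> t0" for t t0 t1
    using that by blast
  have "(s \<in> even_terms J m L \<longrightarrow> ?P s) \<and> (t \<in> odd_terms J m L \<longrightarrow> ?Q t)" for s t
  proof (rule even_terms_odd_terms.induct)
    fix x assume "x \<in> L"
    then obtain x' where "x \<in> C" "h x' = h x" "x' \<in> ind_op (sig_A m) Bot (ring_alg J m C) K"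
      unfolding L_def K_def ind_op_image[OF I] pullback_def by auto
    then show "?P x"
      unfolding ind_op_ring[OF pullback_sub[of I, folded K_def]] by blast
  next
    show "?P {}"
      by (rule PI[OF _ _ refl even_bot]) auto
  next
    fix x y assume "?P x" "?P y"
    then obtain x0 x1 y0 y1 where *: "x \<in> C" "y \<in> C" "x0 \<in> C" "y0 \<in> C" "h x0 = h x" "h y0 = h y"
      "x1 \<in> even_terms J m K" "y1 \<in> even_terms J m K" "x0 \<subseteq> x1" "y0 \<subseteq> y1" by blast
    then show "?P (x \<union> y)"
      by (intro PI[where ?s0.0 = "x0 \<union> y0" and ?s1.0 = "x1 \<union> y1"] even_Un) (auto simp: h_Un)
  next
    fix x k assume "?P x" and k: "1 \<le> k" "k \<le> m"
    then obtain x0 x1 where *: "x \<in> C" "x0 \<in> C" "h x0 = h x"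
      "x1 \<in> even_terms J m K" "x0 \<subseteq> x1" by blast
    then show "?P (E_set J m k x)"
      using k by (intro PI[where ?s0.0 = "E_set J m k x0" and ?s1.0 = "E_set J m k x1"] even_E E_mono)
        (auto simp: h_E)
  next
    fix x assume "?Q x"
    then obtain x0 x1 where *: "x \<in> C" "x0 \<in> C" "h x0 = h x"
      "x1 \<in> odd_terms J m K" "x1 \<subseteq> x0" by blast
    then show "?P (F_set J m x)"
      by (intro PI[where ?s0.0 = "F_set J m x0" and ?s1.0 = "F_set J m x1"] even_F F_anti)
        (auto simp: h_F)
  next
    show "?Q (J \<times> X_set m)"
      by (rule QI[OF _ _ refl odd_top]) auto
  next
    fix x y assume "?Q x" "?Q y"
    then obtain x0 x1 y0 y1 where *: "x \<in> C" "y \<in> C" "x0 \<in> C" "y0 \<in> C" "h x0 = h x" "h y0 = h y"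
      "x1 \<in> odd_terms J m K" "y1 \<in> odd_terms J m K" "x1 \<subseteq> x0" "y1 \<subseteq> y0" by blast
    then show "?Q (x \<inter> y)"
      by (intro QI[where ?t0.0 = "x0 \<inter> y0" and ?t1.0 = "x1 \<inter> y1"] odd_Int) (auto simp: h_Int)
  next
    fix x k assume "?Q x" and k: "1 \<le> k" "k \<le> m"
    then obtain x0 x1 where *: "x \<in> C" "x0 \<in> C" "h x0 = h x"
      "x1 \<in> odd_terms J m K" "x1 \<subseteq> x0" by blast
    then show "?Q (E_set J m k x)"
      using k by (intro QI[where ?t0.0 = "E_set J m k x0" and ?t1.0 = "E_set J m k x1"] odd_E E_mono)
        (auto simp: h_E)
  next
    fix x assume "?P x"
    then obtain x0 x1 where *: "x \<in> C" "x0 \<in> C" "h x0 = h x"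
      "x1 \<in> even_terms J m K" "x0 \<subseteq> x1" by blast
    then show "?Q (F_set J m x)"
      by (intro QI[where ?t0.0 = "F_set J m x0" and ?t1.0 = "F_set J m x1"] odd_F F_anti)
        (auto simp: h_F)
  qed
  then show "s \<in> even_terms J m L \<Longrightarrow> \<exists>s0\<in>C. h s0 = h s \<and> (\<exists>s1\<in>even_terms J m K. s0 \<subseteq> s1)"
    "t \<in> odd_terms J m L \<Longrightarrow> \<exists>t0\<in>C. h t0 = h t \<and> (\<exists>t1\<in>odd_terms J m K. t1 \<subseteq> t0)"
    by blast+
qed

lemma ind_op_idem:
  assumes I: "I \<subseteq> carrier A"
  shows "ind_op (sig_A m) Bot A (ind_op (sig_A m) Bot A I) = ind_op (sig_A m) Bot A I"
proof
  let ?K = "pullback I" and ?L = "pullback (ind_op (sig_A m) Bot A I)"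
  have sub': "ind_op (sig_A m) Bot A I \<subseteq> carrier A"
    by (auto simp: ind_op_def)
  note K = pullback_sub[of I] and L = pullback_sub[of "ind_op (sig_A m) Bot A I"]
  show "ind_op (sig_A m) Bot A I \<subseteq> ind_op (sig_A m) Bot A (ind_op (sig_A m) Bot A I)"
    using gen_rel_least(1)[OF algebra_image _ sub', of Bot]
    by (auto simp: semicongruence_def ind_op_def)
  show "ind_op (sig_A m) Bot A (ind_op (sig_A m) Bot A I) \<subseteq> ind_op (sig_A m) Bot A I"
  proof
    fix a assume "a \<in> ind_op (sig_A m) Bot A (ind_op (sig_A m) Bot A I)"
    then obtain x s l t where a: "a = h x" and x: "x \<in> C" "s \<in> even_terms J m ?L" "x \<subseteq> s"
      "l \<in> ?L" "t \<in> odd_terms J m ?L" "l \<inter> t \<subseteq> x"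
      unfolding ind_op_image[OF sub'] ind_op_ring[OF L] by auto
    obtain s0 s1 where s0: "s0 \<in> C" "h s0 = h s" "s1 \<in> even_terms J m ?K" "s0 \<subseteq> s1"
      using terms_of_pullback_ind_op(1)[OF I x(2)] by blast
    obtain t0 t1 where t0: "t0 \<in> C" "h t0 = h t" "t1 \<in> odd_terms J m ?K" "t1 \<subseteq> t0"
      using terms_of_pullback_ind_op(2)[OF I x(5)] by blast
    obtain l' where "h l' = h l" "l' \<in> ind_op (sig_A m) Bot (ring_alg J m C) ?K"
      using x(4) unfolding ind_op_image[OF I] pullback_def by auto
    then obtain s2 i t2 where l': "h l' = h l" "l' \<in> C" "s2 \<in> even_terms J m ?K" "l' \<subseteq> s2"
      "i \<in> ?K" "t2 \<in> odd_terms J m ?K" "i \<inter> t2 \<subseteq> l'"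
      unfolding ind_op_ring[OF K] by auto
    have mem: "s \<in> C" "t \<in> C" "l \<in> C"
      using x terms_mem[OF L] L by blast+
    \<comment> \<open>Replacing \<open>s\<close>, \<open>t\<close> and \<open>l\<close> by equivalent elements turns \<open>x = (x \<inter> s) \<union> (l \<inter> t)\<close>
      into an element equivalent to \<open>x\<close> that lies between terms over \<open>?K\<close>.\<close>
    define x' where "x' = (x \<inter> s0) \<union> (l' \<inter> t0)"
    have "h x' = h ((x \<inter> s) \<union> (l \<inter> t))"
      unfolding x'_def using x(1) s0(1,2) t0(1,2) l'(1,2) mem by (simp add: h_Un h_Int)
    also have "(x \<inter> s) \<union> (l \<inter> t) = x"
      using x by blast
    finally have hx': "h x' = h x" .
    have "x' \<in> C"
      unfolding x'_def using x(1) s0(1) t0(1) l'(2) by simp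
    moreover have "x' \<subseteq> s1 \<union> s2" "i \<inter> (t2 \<inter> t1) \<subseteq> x'"
      unfolding x'_def using s0(4) t0(4) l'(4,7) by blast+
    ultimately have "x' \<in> ind_op (sig_A m) Bot (ring_alg J m C) ?K"
      unfolding ind_op_ring[OF K]
      using even_Un[OF s0(3) l'(3)] odd_Int[OF l'(6) t0(3)] l'(5) by blast
    then show "a \<in> ind_op (sig_A m) Bot A I"
      unfolding ind_op_image[OF I] a hx'[symmetric] by blast
  qed
qed

end

section \<open>The deductive operator stabilizes after $m-1$ steps\<close>

text \<open>Levels above \<open>g\<close> are treated as level \<open>0\<close>. This is the composite of the operations
  \<open>E_set J m k\<close> with \<open>k > g\<close>, hence available in every ring; for \<open>g = 0\<close> it yields
  the union of the full columns over the points of level \<open>0\<close>.\<close>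

definition trunc :: "'j set \<Rightarrow> nat \<Rightarrow> nat \<Rightarrow> ('j \<times> nat) set \<Rightarrow> ('j \<times> nat) set" where
  "trunc J m g y = {(j, h) \<in> J \<times> X_set m. (j, if h \<le> g then h else 0) \<in> y}"

lemma trunc_mem:
  "(j, h) \<in> trunc J m g y \<longleftrightarrow> j \<in> J \<and> h \<in> X_set m \<and> (j, if h \<le> g then h else 0) \<in> y"
  by (simp add: trunc_def)

lemma trunc_step: "trunc J m g y = E_set J m (Suc g) (trunc J m (Suc g) y)"
  by (auto simp: trunc_mem E_set_mem tau_def X_set_def le_Suc_eq split: if_splits)

lemma trunc_top: "y \<subseteq> J \<times> X_set m \<Longrightarrow> trunc J m m y = y"
  by (auto simp: trunc_mem X_set_def)

lemma trunc_closed: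
  assumes "y \<subseteq> J \<times> X_set m" "y \<in> S" "g \<le> m"
    and "\<And>x k. x \<in> S \<Longrightarrow> 1 \<le> k \<Longrightarrow> k \<le> m \<Longrightarrow> E_set J m k x \<in> S"
  shows "trunc J m g y \<in> S"
  using assms(3)
proof (induction g rule: inc_induct)
  case base
  then show ?case using assms by (simp add: trunc_top)
next
  case (step g)
  then show ?case using assms(4) by (subst trunc_step) auto
qed

context set_ring
begin

abbreviation ded :: "('j \<times> nat) set set \<Rightarrow> ('j \<times> nat) set set" where
  "ded \<equiv> ded_op (sig_A m) Bot (ring_alg J m C)"

lemma ded_sub: "ded K \<subseteq> C"
  by (auto simp: ded_op_def)

lemma ded_increasing: "K \<subseteq> C \<Longrightarrow> K \<subseteq> ded K"
  unfolding ded_op_ring using odd_top by blast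

lemma iter_sub: "K \<subseteq> C \<Longrightarrow> (ded ^^ n) K \<subseteq> C"
  using ded_sub by (cases n) auto

lemma iter_increasing: "K \<subseteq> C \<Longrightarrow> (ded ^^ n) K \<subseteq> (ded ^^ Suc n) K"
  using ded_increasing[OF iter_sub] by simp

lemma iter_mono:
  assumes "K \<subseteq> C" "n \<le> k"
  shows "(ded ^^ n) K \<subseteq> (ded ^^ k) K"
  using iter_increasing[OF assms(1)] assms(2) by (rule lift_Suc_mono_le[of "\<lambda>n. (ded ^^ n) K"])

text \<open>The bound \<open>i\<close> may always be taken from the initial set, because a bound from an iterate
  is itself bounded, up to an odd term, by an element of the initial set. Only the odd terms
  grow in the iteration.\<close>

lemma iter_Suc:
  assumes K: "K \<subseteq> C"
  shows "(ded ^^ Suc n) K = {x \<in> C. \<exists>i\<in>K. \<exists>t\<in>odd_terms J m ((ded ^^ n) K). x \<inter> t \<subseteq> i}"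
proof (induction n)
  case 0
  then show ?case by (simp add: ded_op_ring[OF K])
next
  case (Suc n)
  let ?D = "(ded ^^ Suc n) K"
  have eq: "(ded ^^ Suc (Suc n)) K = {x \<in> C. \<exists>i\<in>?D. \<exists>t\<in>odd_terms J m ?D. x \<inter> t \<subseteq> i}"
    using ded_op_ring[OF iter_sub[OF K, of "Suc n"]] by simp
  show ?case
    unfolding eq
  proof (intro set_eqI iffI)
    fix x assume "x \<in> {x \<in> C. \<exists>i\<in>?D. \<exists>t\<in>odd_terms J m ?D. x \<inter> t \<subseteq> i}"
    then obtain i t where x: "x \<in> C" "i \<in> ?D" "t \<in> odd_terms J m ?D" "x \<inter> t \<subseteq> i" by blast
    from x(2) obtain i' t' where i': "i' \<in> K" "t' \<in> odd_terms J m ((ded ^^ n) K)" "i \<inter> t' \<subseteq> i'"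
      unfolding Suc.IH by blast
    have "t \<inter> t' \<in> odd_terms J m ?D"
      using x(3) i'(2) terms_mono(2)[OF iter_increasing[OF K]] by (blast intro: odd_Int)
    moreover have "x \<inter> (t \<inter> t') \<subseteq> i'"
      using x(4) i'(3) by blast
    ultimately show "x \<in> {x \<in> C. \<exists>i\<in>K. \<exists>t\<in>odd_terms J m ?D. x \<inter> t \<subseteq> i}"
      using x(1) i'(1) by blast
  next
    fix x assume "x \<in> {x \<in> C. \<exists>i\<in>K. \<exists>t\<in>odd_terms J m ?D. x \<inter> t \<subseteq> i}"
    then show "x \<in> {x \<in> C. \<exists>i\<in>?D. \<exists>t\<in>odd_terms J m ?D. x \<inter> t \<subseteq> i}"
      using iter_mono[OF K, of 0 "Suc n"] by auto
  qed
qed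

end

text \<open>One level is gained for odd terms: \<open>F_set\<close> replaces \<open>(j, h)\<close> by
  \<open>(j, h - 1)\<close>, and in an odd term every generator stands below at least one
  \<open>F_set\<close>. The element \<open>s\<close> collects
  the columns that are left out of the comparison.\<close>

lemma terms_agree_on_levels:
  fixes K Y Y' :: "('j \<times> nat) set set"
  assumes Y: "\<And>y. y \<in> Y \<Longrightarrow> \<exists>y'\<in>Y'. \<exists>s\<in>even_terms J m K.
    \<forall>j h. (j, 0) \<notin> s \<and> h \<le> g \<and> (j, h) \<in> y \<longrightarrow> (j, h) \<in> y'"
  shows "x \<in> even_terms J m Y \<Longrightarrow> \<exists>x'\<in>even_terms J m Y'. \<exists>s\<in>even_terms J m K.
      \<forall>j h. (j, 0) \<notin> s \<and> h \<le> g \<and> (j, h) \<in> x \<longrightarrow> (j, h) \<in> x'"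
    and "z \<in> odd_terms J m Y \<Longrightarrow> \<exists>z'\<in>odd_terms J m Y'. \<exists>s\<in>even_terms J m K.
      \<forall>j h. (j, 0) \<notin> s \<and> h \<le> Suc g \<and> (j, h) \<in> z' \<longrightarrow> (j, h) \<in> z"
proof -
  let ?P = "\<lambda>x. \<exists>x'\<in>even_terms J m Y'. \<exists>s\<in>even_terms J m K.
      \<forall>j h. (j, 0) \<notin> s \<and> h \<le> g \<and> (j, h) \<in> x \<longrightarrow> (j, h) \<in> x'"
  let ?Q = "\<lambda>z. \<exists>z'\<in>odd_terms J m Y'. \<exists>s\<in>even_terms J m K.
      \<forall>j h. (j, 0) \<notin> s \<and> h \<le> Suc g \<and> (j, h) \<in> z' \<longrightarrow> (j, h) \<in> z"
  have PI: "?P x" if "x' \<in> even_terms J m Y'" "s \<in> even_terms J m K"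
    "\<And>j h. (j, 0) \<notin> s \<Longrightarrow> h \<le> g \<Longrightarrow> (j, h) \<in> x \<Longrightarrow> (j, h) \<in> x'" for x x' s
    by (rule bexI[OF bexI[OF _ that(2)] that(1)]) (simp add: that(3))
  have QI: "?Q z" if "z' \<in> odd_terms J m Y'" "s \<in> even_terms J m K"
    "\<And>j h. (j, 0) \<notin> s \<Longrightarrow> h \<le> Suc g \<Longrightarrow> (j, h) \<in> z' \<Longrightarrow> (j, h) \<in> z" for z z' s
    by (rule bexI[OF bexI[OF _ that(2)] that(1)]) (simp add: that(3))
  have "(x \<in> even_terms J m Y \<longrightarrow> ?P x) \<and> (z \<in> odd_terms J m Y \<longrightarrow> ?Q z)" for x z
  proof (rule even_terms_odd_terms.induct)
    fix y assume "y \<in> Y"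
    then show "?P y" using Y even_gen by metis
  next
    show "?P {}" by (rule PI[OF even_bot even_bot])
  next
    fix x y assume "?P x" "?P y"
    then obtain x' s y' s' where *: "x' \<in> even_terms J m Y'" "s \<in> even_terms J m K"
      "y' \<in> even_terms J m Y'" "s' \<in> even_terms J m K"
      "\<forall>j h. (j, 0) \<notin> s \<and> h \<le> g \<and> (j, h) \<in> x \<longrightarrow> (j, h) \<in> x'"
      "\<forall>j h. (j, 0) \<notin> s' \<and> h \<le> g \<and> (j, h) \<in> y \<longrightarrow> (j, h) \<in> y'" by blast
    show "?P (x \<union> y)"
      by (rule PI[OF even_Un[OF *(1,3)] even_Un[OF *(2,4)]])
        (use *(5,6) in blast)
  next
    fix x k assume "?P x" and k: "1 \<le> k" "k \<le> m"
    then obtain x' s where *: "x' \<in> even_terms J m Y'" "s \<in> even_terms J m K"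
      "\<forall>j h. (j, 0) \<notin> s \<and> h \<le> g \<and> (j, h) \<in> x \<longrightarrow> (j, h) \<in> x'" by blast
    show "?P (E_set J m k x)"
      by (rule PI[OF even_E[OF *(1) k] *(2)])
        (use *(3) in \<open>auto simp: E_set_mem tau_def\<close>)
  next
    fix x assume "?Q x"
    then obtain x' s where *: "x' \<in> odd_terms J m Y'" "s \<in> even_terms J m K"
      "\<forall>j h. (j, 0) \<notin> s \<and> h \<le> Suc g \<and> (j, h) \<in> x' \<longrightarrow> (j, h) \<in> x" by blast
    have "(j, h) \<in> F_set J m x'" if "(j, 0) \<notin> s" "h \<le> g" "(j, h) \<in> F_set J m x" for j h
    proof -
      have "(j, sigma h) \<in> x' \<longrightarrow> (j, sigma h) \<in> x"
        using *(3) that(1,2) by (simp add: sigma_def)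
      with that(3) show ?thesis
        by (auto simp: F_set_mem)
    qed
    then show "?P (F_set J m x)"
      by (rule PI[OF even_F[OF *(1)] *(2)])
  next
    show "?Q (J \<times> X_set m)" by (rule QI[OF odd_top even_bot])
  next
    fix x y assume "?Q x" "?Q y"
    then obtain x' s y' s' where *: "x' \<in> odd_terms J m Y'" "s \<in> even_terms J m K"
      "y' \<in> odd_terms J m Y'" "s' \<in> even_terms J m K"
      "\<forall>j h. (j, 0) \<notin> s \<and> h \<le> Suc g \<and> (j, h) \<in> x' \<longrightarrow> (j, h) \<in> x"
      "\<forall>j h. (j, 0) \<notin> s' \<and> h \<le> Suc g \<and> (j, h) \<in> y' \<longrightarrow> (j, h) \<in> y" by blast
    show "?Q (x \<inter> y)"
      by (rule QI[OF odd_Int[OF *(1,3)] even_Un[OF *(2,4)]])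
        (use *(5,6) in blast)
  next
    fix x k assume "?Q x" and k: "1 \<le> k" "k \<le> m"
    then obtain x' s where *: "x' \<in> odd_terms J m Y'" "s \<in> even_terms J m K"
      "\<forall>j h. (j, 0) \<notin> s \<and> h \<le> Suc g \<and> (j, h) \<in> x' \<longrightarrow> (j, h) \<in> x" by blast
    show "?Q (E_set J m k x)"
      by (rule QI[OF odd_E[OF *(1) k] *(2)])
        (use *(3) in \<open>auto simp: E_set_mem tau_def\<close>)
  next
    fix x assume "?P x"
    then obtain x' s where *: "x' \<in> even_terms J m Y'" "s \<in> even_terms J m K"
      "\<forall>j h. (j, 0) \<notin> s \<and> h \<le> g \<and> (j, h) \<in> x \<longrightarrow> (j, h) \<in> x'" by blast
    have "(j, h) \<in> F_set J m x" if "(j, 0) \<notin> s" "h \<le> Suc g" "(j, h) \<in> F_set J m x'" for j h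
    proof -
      have "(j, sigma h) \<in> x \<longrightarrow> (j, sigma h) \<in> x'"
        using *(3) that(1,2) by (simp add: sigma_def)
      with that(3) show ?thesis
        by (auto simp: F_set_mem)
    qed
    then show "?Q (F_set J m x)"
      by (rule QI[OF odd_F[OF *(1)] *(2)])
  qed
  then show "x \<in> even_terms J m Y \<Longrightarrow> ?P x" "z \<in> odd_terms J m Y \<Longrightarrow> ?Q z"
    by blast+
qed

lemma terms_empty:
  shows "even_terms J m {{}} \<subseteq> {{}}" and "odd_terms J m {{}} \<subseteq> {J \<times> X_set m}"
proof -
  have "(x \<in> even_terms J m {{}} \<longrightarrow> x = {}) \<and> (z \<in> odd_terms J m {{}} \<longrightarrow> z = J \<times> X_set m)" for x z
  proof (rule even_terms_odd_terms.induct)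
  qed (simp_all add: F_empty F_top E_empty E_top)
  then show "even_terms J m {{}} \<subseteq> {{}}" "odd_terms J m {{}} \<subseteq> {J \<times> X_set m}"
    by blast+
qed

context set_ring
begin

text \<open>Outside the columns of \<open>s\<close>, elements of \<open>Y\<close> look like the empty set at level
  \<open>0\<close>, so odd terms look like the only odd term over the empty set up to level \<open>1\<close>.\<close>

lemma odd_terms_level_1:
  assumes Y: "\<And>y. y \<in> Y \<Longrightarrow> \<exists>s\<in>even_terms J m K. \<forall>j. (j, 0) \<in> y \<longrightarrow> (j, 0) \<in> s"
    and t: "t \<in> odd_terms J m Y"
  shows "\<exists>s\<in>even_terms J m K.
    \<forall>j h. (j, 0) \<notin> s \<and> h \<le> Suc 0 \<and> (j, h) \<in> J \<times> X_set m \<longrightarrow> (j, h) \<in> t"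
proof -
  have "\<exists>y'\<in>{{}}. \<exists>s\<in>even_terms J m K.
      \<forall>j h. (j, 0) \<notin> s \<and> h \<le> 0 \<and> (j, h) \<in> y \<longrightarrow> (j, h) \<in> y'" if "y \<in> Y" for y
    using Y[OF that] by auto
  from terms_agree_on_levels(2)[OF this t] show ?thesis
    using terms_empty(2)[of J m] by blast
qed

lemma iter_level_0:
  assumes K: "K \<subseteq> C" and y: "y \<in> (ded ^^ n) K"
  shows "\<exists>s\<in>even_terms J m K. \<forall>j. (j, 0) \<in> y \<longrightarrow> (j, 0) \<in> s"
  using y
proof (induction n arbitrary: y)
  case 0
  then show ?case by (auto intro!: bexI[of _ y] even_gen)
next
  case (Suc n)
  from Suc.prems obtain i t where y: "y \<in> C" "i \<in> K" "t \<in> odd_terms J m ((ded ^^ n) K)" "y \<inter> t \<subseteq> i"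
    unfolding iter_Suc[OF K] by blast
  from odd_terms_level_1[OF Suc.IH y(3)] obtain s where s: "s \<in> even_terms J m K"
    "\<forall>j h. (j, 0) \<notin> s \<and> h \<le> Suc 0 \<and> (j, h) \<in> J \<times> X_set m \<longrightarrow> (j, h) \<in> t" by blast
  have "(j, 0) \<in> s \<union> i" if "(j, 0) \<in> y" for j
  proof (cases "(j, 0) \<in> s")
    case False
    moreover have "(j, 0) \<in> J \<times> X_set m" using that y(1) sub by blast
    ultimately have "(j, 0) \<in> t" using s(2) by blast
    then show ?thesis using that y(4) by blast
  qed simp
  then show ?case
    using even_Un[OF s(1) even_gen[OF y(2)]] by blast
qed

text \<open>Let \<open>y \<inter> t \<subseteq> i\<close>. By assumption \<open>t\<close> contains an odd term \<open>t'\<close> over the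
  \<open>g\<close>-th iterate as far as levels up to \<open>g + 2\<close> are concerned, which is enough for
  the truncation of \<open>y\<close>. Truncation may add points only in columns where \<open>y\<close> contains
  the point of level \<open>0\<close>; these and the exceptional columns are removed by the odd term
  \<open>F_set J m (trunc J m 0 u)\<close>.\<close>

lemma trunc_in_iter:
  assumes K: "K \<subseteq> C" and g: "Suc (Suc g) \<le> m" and y: "y \<in> (ded ^^ n) K"
    and IH: "\<And>y. y \<in> (ded ^^ n) K \<Longrightarrow> \<exists>y'\<in>(ded ^^ g) K. \<exists>s\<in>even_terms J m K.
      \<forall>j h. (j, 0) \<notin> s \<and> h \<le> Suc g \<and> (j, h) \<in> y \<longrightarrow> (j, h) \<in> y'"
  shows "trunc J m (Suc (Suc g)) y \<in> (ded ^^ Suc g) K"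
proof -
  have "y \<in> (ded ^^ Suc n) K"
    using y iter_increasing[OF K] by blast
  then obtain i t where y': "y \<in> C" "i \<in> K" "t \<in> odd_terms J m ((ded ^^ n) K)" "y \<inter> t \<subseteq> i"
    unfolding iter_Suc[OF K] by blast
  from terms_agree_on_levels(2)[OF IH y'(3)] obtain t' s where t':
    "t' \<in> odd_terms J m ((ded ^^ g) K)" "s \<in> even_terms J m K"
    "\<forall>j h. (j, 0) \<notin> s \<and> h \<le> Suc (Suc g) \<and> (j, h) \<in> t' \<longrightarrow> (j, h) \<in> t" by blast
  obtain s' where s': "s' \<in> even_terms J m K" "\<forall>j. (j, 0) \<in> y \<longrightarrow> (j, 0) \<in> s'"
    using iter_level_0[OF K y] by blast
  define u where "u = s \<union> s'"
  have u: "u \<in> even_terms J m K"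
    unfolding u_def using t'(2) s'(1) by (rule even_Un)
  then have "trunc J m 0 u \<in> even_terms J m K"
    using terms_mem(1)[OF K] sub by (intro trunc_closed even_E) auto
  then have "F_set J m (trunc J m 0 u) \<in> odd_terms J m ((ded ^^ g) K)"
    using terms_mono(2)[of K "(ded ^^ g) K"] iter_mono[OF K, of 0 g] by (auto dest: odd_F)
  then have odd: "t' \<inter> F_set J m (trunc J m 0 u) \<in> odd_terms J m ((ded ^^ g) K)"
    by (rule odd_Int[OF t'(1)])
  have "trunc J m (Suc (Suc g)) y \<inter> (t' \<inter> F_set J m (trunc J m 0 u)) \<subseteq> i"
  proof clarify
    fix j h assume *: "(j, h) \<in> trunc J m (Suc (Suc g)) y" "(j, h) \<in> t'"
      "(j, h) \<in> F_set J m (trunc J m 0 u)"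
    then have "(j, 0) \<notin> u"
      by (auto simp: F_set_mem trunc_mem split: if_splits)
    then have "(j, 0) \<notin> s" "(j, 0) \<notin> y"
      using s'(2) by (auto simp: u_def)
    with *(1) have "h \<le> Suc (Suc g)" "(j, h) \<in> y"
      by (auto simp: trunc_mem split: if_splits)
    then show "(j, h) \<in> i"
      using t'(3) \<open>(j, 0) \<notin> s\<close> *(2) y'(4) by blast
  qed
  moreover have "trunc J m (Suc (Suc g)) y \<in> C"
    using y'(1) sub g by (intro trunc_closed) auto
  ultimately show ?thesis
    unfolding iter_Suc[OF K] using odd y'(2) by blast
qed

lemma iter_agree_on_levels:
  assumes K: "K \<subseteq> C" and g: "Suc g \<le> m" and y: "y \<in> (ded ^^ n) K"
  shows "\<exists>y'\<in>(ded ^^ g) K. \<exists>s\<in>even_terms J m K.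
      \<forall>j h. (j, 0) \<notin> s \<and> h \<le> Suc g \<and> (j, h) \<in> y \<longrightarrow> (j, h) \<in> y'"
  using g y
proof (induction g arbitrary: n y)
  case 0
  have "y \<in> (ded ^^ Suc n) K"
    using 0 iter_increasing[OF K] by blast
  then obtain i t where y: "y \<in> C" "i \<in> K" "t \<in> odd_terms J m ((ded ^^ n) K)" "y \<inter> t \<subseteq> i"
    unfolding iter_Suc[OF K] by blast
  from odd_terms_level_1[OF iter_level_0[OF K, where n = n] y(3)] obtain s where s: "s \<in> even_terms J m K"
    "\<forall>j h. (j, 0) \<notin> s \<and> h \<le> Suc 0 \<and> (j, h) \<in> J \<times> X_set m \<longrightarrow> (j, h) \<in> t" by blast
  have "\<forall>j h. (j, 0) \<notin> s \<and> h \<le> Suc 0 \<and> (j, h) \<in> y \<longrightarrow> (j, h) \<in> i"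
    using s(2) y(1,4) sub by blast
  then show ?case
    using y(2) s(1) by auto
next
  case (Suc g)
  have g: "Suc g \<le> m" using Suc.prems by simp
  have "trunc J m (Suc (Suc g)) y \<in> (ded ^^ Suc g) K"
    using Suc.IH[OF g] by (rule trunc_in_iter[OF K Suc.prems])
  moreover have "(j, h) \<in> trunc J m (Suc (Suc g)) y" if "h \<le> Suc (Suc g)" "(j, h) \<in> y" for j h
    using that iter_sub[OF K, of n] Suc.prems(2) sub by (fastforce simp: trunc_mem)
  ultimately show ?case
    using even_bot by blast
qed

text \<open>At \<open>g + 2 = m\<close> truncation is the identity.\<close>

lemma iter_stable:
  assumes K: "K \<subseteq> C" and m: "2 \<le> m"
  shows "(ded ^^ n) K \<subseteq> (ded ^^ (m - 1)) K"
proof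
  fix y assume y: "y \<in> (ded ^^ n) K"
  obtain g where g: "m = Suc (Suc g)"
    using m by (metis add_2_eq_Suc le_Suc_ex)
  have "trunc J m (Suc (Suc g)) y \<in> (ded ^^ Suc g) K"
    by (rule trunc_in_iter[OF K _ y iter_agree_on_levels[OF K]]) (simp_all add: g)
  moreover have "trunc J m m y = y"
    using y iter_sub[OF K] sub by (intro trunc_top) blast
  ultimately show "y \<in> (ded ^^ (m - 1)) K"
    by (simp add: g)
qed

end

section \<open>Rings of sets represent the variety generated by $A_m$\<close>

text \<open>The reindexing \<open>v\<close> makes it possible to realize a ring over natural numbers as a
  subalgebra of a power indexed by another type.\<close>

definition decode :: "('i \<Rightarrow> 'j) \<Rightarrow> 'i set \<Rightarrow> ('j \<times> nat) set \<Rightarrow> 'i \<Rightarrow> nat set" where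
  "decode v I U = (\<lambda>i\<in>I. {h. (v i, h) \<in> U})"

lemma decode_oper:
  assumes v: "v ` I \<subseteq> J" and B: "\<And>i. i \<in> I \<Longrightarrow> B i = alg_A m"
    and f: "sig_A m f = Some n" "length us = n"
  shows "decode v I (set_oper J m f us) = oper (prod_alg I B) f (map (decode v I) us)"
proof
  fix i
  show "decode v I (set_oper J m f us) i = oper (prod_alg I B) f (map (decode v I) us) i"
  proof (cases "i \<in> I")
    case True
    then have "v i \<in> J" using v by blast
    with f True show ?thesis
      by (cases rule: sig_A_cases)
        (auto simp: decode_def prod_alg_def B alg_A_def F_set_def E_set_def)
  next
    case False
    then show ?thesis by (simp add: decode_def prod_alg_def)
  qed
qed

lemma set_ring_Pow: "set_ring J m (Pow (J \<times> X_set m))"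
  by unfold_locales (auto simp: F_set_def E_set_def)

lemma HSP_imp_ring_image:
  fixes A :: "(opsym, 'a) alg"
  assumes "A \<in> HSP TYPE('i) (sig_A m) {alg_A m}"
  obtains J :: "'i set" and C h where "ring_image J m C A h"
proof -
  from assms obtain M g where A: "algebra (sig_A m) A"
    and M: "M \<in> op_S (sig_A m) (op_P {alg_A m} :: (opsym, 'i \<Rightarrow> nat set) alg set)"
    and gM: "g \<in> hom (sig_A m) M A" "g ` carrier M = carrier A"
    unfolding HSP_def op_H_def by blast
  from M obtain I :: "'i set" and B S where "M = prod_alg I B\<lparr>carrier := S\<rparr>"
    and B: "\<And>i. i \<in> I \<Longrightarrow> B i = alg_A m"
    and S: "subuniverse (sig_A m) (prod_alg I B) S"
    unfolding op_S_def op_P_def by blast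
  with gM have g: "g \<in> hom (sig_A m) (prod_alg I B\<lparr>carrier := S\<rparr>) A" "g ` S = carrier A"
    by simp_all
  define D where "D = (decode id I :: ('i \<times> nat) set \<Rightarrow> 'i \<Rightarrow> nat set)"
  define C where "C = {U \<in> Pow (I \<times> X_set m). D U \<in> S}"
  have D_oper: "D (set_oper I m f us) = oper (prod_alg I B) f (map D us)"
    if "sig_A m f = Some n" "length us = n" for f n us
    unfolding D_def by (rule decode_oper[OF _ B that]) auto
  have "closed_under (sig_A m) (ring_alg I m C) C"
    unfolding closed_under_def
  proof (intro allI impI, elim conjE)
    fix f n us assume *: "sig_A m f = Some n" "length us = n" "set us \<subseteq> C"
    then have "set us \<subseteq> Pow (I \<times> X_set m)" "set (map D us) \<subseteq> S"
      by (auto simp: C_def)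
    moreover from this have "oper (prod_alg I B) f (map D us) \<in> S"
      using S *(1,2) by (intro closed_underD[of "sig_A m" _ S f n]) (auto simp: subuniverse_def)
    ultimately show "oper (ring_alg I m C) f us \<in> C"
      using D_oper[OF *(1,2)] set_ring.oper_mem[OF set_ring_Pow *(1,2), of I] by (simp add: C_def)
  qed
  then have ring: "set_ring I m C"
    by (auto simp: set_ring_iff C_def)
  have onto: "D ` C = S"
  proof
    show "D ` C \<subseteq> S" by (auto simp: C_def)
    show "S \<subseteq> D ` C"
    proof
      fix x assume x: "x \<in> S"
      then have xP: "x \<in> (\<Pi>\<^sub>E i\<in>I. Pow (X_set m))"
      proof -
        have "x \<in> (\<Pi>\<^sub>E i\<in>I. carrier (B i))"
          using S x by (auto simp: subuniverse_def prod_alg_def)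
        also have "\<dots> = (\<Pi>\<^sub>E i\<in>I. Pow (X_set m))"
          by (rule PiE_cong) (simp add: B alg_A_def)
        finally show ?thesis .
      qed
      define U where "U = {(i, h). i \<in> I \<and> h \<in> x i}"
      have "D U = x"
        using xP by (auto simp: D_def decode_def U_def PiE_def extensional_def fun_eq_iff)
      moreover have "U \<subseteq> I \<times> X_set m"
        using xP by (auto simp: U_def PiE_iff)
      ultimately show "x \<in> D ` C"
        using x by (force simp: C_def)
    qed
  qed
  have "g \<circ> D \<in> hom (sig_A m) (ring_alg I m C) A"
    unfolding hom_def
  proof (intro CollectI conjI allI impI; (elim conjE)?)
    show "(g \<circ> D) ` carrier (ring_alg I m C) \<subseteq> carrier A"
      using onto g(2) by auto
    fix f n us assume *: "sig_A m f = Some n" "length us = n" "set us \<subseteq> carrier (ring_alg I m C)"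
    have "set (map D us) \<subseteq> S"
      using *(3) onto by auto
    then show "(g \<circ> D) (oper (ring_alg I m C) f us) = oper A f (map (g \<circ> D) us)"
      using D_oper[OF *(1,2)] hom_oper[OF g(1) *(1), of "map D us"] *(2) by simp
  qed
  moreover have "(g \<circ> D) ` C = carrier A"
    using onto g(2) by (simp only: image_comp[symmetric])
  ultimately have "ring_image I m C A (g \<circ> D)"
    using ring A by (intro ring_image.intro ring_image_axioms.intro)
  then show thesis by (rule that)
qed

lemma ring_image_imp_HSP:
  fixes A :: "(opsym, 'a) alg" and v :: "'i \<Rightarrow> 'j"
  assumes "ring_image J m C A h" and v: "v ` I = J"
  shows "A \<in> HSP TYPE('i) (sig_A m) {alg_A m}"
proof -
  interpret ring_image J m C A h by fact
  define D where "D = decode v I"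
  define P where "P = prod_alg I (\<lambda>_. alg_A m)"
  define E where "E = inv_into C D"
  have D_oper: "D (set_oper J m f us) = oper P f (map D us)"
    if "sig_A m f = Some n" "length us = n" for f n us
    unfolding D_def P_def using v by (intro decode_oper[OF _ _ that]) auto
  have "inj_on D C"
  proof (rule inj_onI)
    fix U U' assume *: "U \<in> C" "U' \<in> C" "D U = D U'"
    have "(v i, k) \<in> U \<longleftrightarrow> (v i, k) \<in> U'" if "i \<in> I" for i k
      using fun_cong[OF *(3), of i] that by (auto simp: D_def decode_def)
    then show "U = U'"
      using *(1,2) sub v by blast
  qed
  then have ED: "E (D U) = U" if "U \<in> C" for U
    using that by (simp add: E_def)
  have subuniv: "subuniverse (sig_A m) P (D ` C)"
    unfolding subuniverse_def closed_under_def
  proof (intro conjI allI impI; (elim conjE)?)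
    show "D ` C \<subseteq> carrier P"
      using sub by (fastforce simp: D_def decode_def P_def prod_alg_def alg_A_def)
    fix f n xs assume *: "sig_A m f = Some n" "length xs = n" "set xs \<subseteq> D ` C"
    have "set (map E xs) \<subseteq> C" "map D (map E xs) = xs"
      using *(3) ED by (auto intro!: map_idI)
    then show "oper P f xs \<in> D ` C"
      using D_oper[OF *(1), of "map E xs"] oper_mem[OF *(1), of "map E xs"] *(2) by (metis image_eqI length_map)
  qed
  have "h \<circ> E \<in> hom (sig_A m) (P\<lparr>carrier := D ` C\<rparr>) A"
    unfolding hom_def
  proof (intro CollectI conjI allI impI; (elim conjE)?)
    show "(h \<circ> E) ` carrier (P\<lparr>carrier := D ` C\<rparr>) \<subseteq> carrier A"
      using ED h_onto by auto
    fix f n xs assume *: "sig_A m f = Some n" "length xs = n"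
      "set xs \<subseteq> carrier (P\<lparr>carrier := D ` C\<rparr>)"
    have E: "set (map E xs) \<subseteq> C" "map D (map E xs) = xs"
      using *(3) ED by (auto intro!: map_idI)
    have "E (oper P f xs) = set_oper J m f (map E xs)"
      using D_oper[OF *(1), of "map E xs"] oper_mem[OF *(1), of "map E xs"] *(2) E ED by (metis length_map)
    then show "(h \<circ> E) (oper (P\<lparr>carrier := D ` C\<rparr>) f xs) = oper A f (map (h \<circ> E) xs)"
      using hom_oper[OF h_hom *(1), of "map E xs"] *(2) E(1) by simp
  qed
  moreover have "(h \<circ> E) ` carrier (P\<lparr>carrier := D ` C\<rparr>) = carrier A"
    using ED h_onto by (simp add: image_image)
  moreover have "P \<in> op_P {alg_A m}"
    unfolding op_P_def P_def by blast
  then have "P\<lparr>carrier := D ` C\<rparr> \<in> op_S (sig_A m) (op_P {alg_A m})"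
    unfolding op_S_def using subuniv empty_mem by blast
  ultimately show ?thesis
    unfolding HSP_def op_H_def
    by (intro CollectI conjI algebra_image
        bexI[where x = "h \<circ> E"] bexI[where x = "P\<lparr>carrier := D ` C\<rparr>"])
qed

lemma (in set_ring) isomorphic_copy:
  assumes h: "inj_on h C"
  shows "\<exists>A. ring_image J m C A h"
proof -
  define A where "A = \<lparr>carrier = h ` C, oper = (\<lambda>f xs. h (set_oper J m f (map (inv_into C h) xs)))\<rparr>"
  have "algebra (sig_A m) A"
    unfolding algebra_def closed_under_def
  proof (intro conjI allI impI; (elim conjE)?)
    show "carrier A \<noteq> {}" using algebra_ring by (simp add: A_def algebra_def)
    fix f n xs assume *: "sig_A m f = Some n" "length xs = n" "set xs \<subseteq> carrier A"
    then have "set (map (inv_into C h) xs) \<subseteq> C"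
      by (auto simp: A_def intro: inv_into_into)
    then show "oper A f xs \<in> carrier A"
      using oper_mem[OF *(1), of "map (inv_into C h) xs"] *(2) by (simp add: A_def)
  qed
  moreover have "h \<in> hom (sig_A m) (ring_alg J m C) A"
    unfolding hom_def
  proof (intro CollectI conjI allI impI; (elim conjE)?)
    fix f n us assume "set us \<subseteq> carrier (ring_alg J m C)"
    then have "map (inv_into C h \<circ> h) us = us"
      using h by (intro map_idI) auto
    then show "h (oper (ring_alg J m C) f us) = oper A f (map h us)"
      by (simp add: A_def)
  qed (simp add: A_def)
  moreover have "h ` C = carrier A"
    by (simp add: A_def)
  ultimately have "ring_image J m C A h"
    using set_ring_axioms by (intro ring_image.intro ring_image_axioms.intro)
  then show ?thesis ..
qed

section \<open>A ring on which the deductive operator needs $m-1$ steps\<close>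

text \<open>The upsets of the following order: the points of level \<open>0\<close> are identified, and
  \<open>(k, h)\<close> with \<open>1 \<le> h \<le> k\<close> and \<open>k + h\<close> even lies below \<open>(k - 1, h)\<close> and
  \<open>(k + 1, h)\<close>. The parity makes the direction alternate from each level to the next, as is
  required for closure under \<open>F_set\<close>.\<close>

definition zigzag_ring :: "nat \<Rightarrow> (nat \<times> nat) set set" where
  "zigzag_ring m = {U. U \<subseteq> {1..m} \<times> X_set m \<and>
     (\<forall>k l. (k, 0) \<in> U \<and> l \<in> {1..m} \<longrightarrow> (l, 0) \<in> U) \<and>
     (\<forall>k h l. (k, h) \<in> U \<and> 1 \<le> h \<and> h \<le> k \<and> even (k + h) \<and> l \<in> {1..m} \<and>
        (l = Suc k \<or> k = Suc l) \<longrightarrow> (l, h) \<in> U)}"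

text \<open>Every point of the diagonal other than \<open>(1, 1)\<close>, which starts the process, has to be
  delayed by its left upper neighbour \<open>(k - 1, k)\<close> alone. The point \<open>(k, k - 1)\<close> is in the
  seed so that \<open>F_set\<close> of the seed omits \<open>(k, k)\<close> itself, and the right upper neighbour
  \<open>(k + 1, k)\<close> of \<open>(k, k)\<close> is a point of the seed by the same rule.\<close>

definition seed :: "nat \<Rightarrow> (nat \<times> nat) set" where
  "seed m = {(k, h) \<in> {1..m} \<times> X_set m. 1 \<le> h \<and> (k = Suc h \<or> k = 1 \<and> h = 1)}"

text \<open>The principal upset of \<open>(g, g)\<close> in the zigzag order, for \<open>1 \<le> g \<le> m\<close>.\<close>

definition upset :: "nat \<Rightarrow> nat \<Rightarrow> (nat \<times> nat) set" where
  "upset m g = {(k, h) \<in> {1..m} \<times> X_set m. h = g \<and> (k = g \<or> k = Suc g \<or> g = Suc k)}"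

lemma zigzag_ring_mem:
  "U \<in> zigzag_ring m \<longleftrightarrow> U \<subseteq> {1..m} \<times> X_set m \<and>
     (\<forall>k l. (k, 0) \<in> U \<and> l \<in> {1..m} \<longrightarrow> (l, 0) \<in> U) \<and>
     (\<forall>k h l. (k, h) \<in> U \<and> 1 \<le> h \<and> h \<le> k \<and> even (k + h) \<and> l \<in> {1..m} \<and>
        (l = Suc k \<or> k = Suc l) \<longrightarrow> (l, h) \<in> U)"
  unfolding zigzag_ring_def by (rule mem_Collect_eq)

lemma zigzag_ring_sub: "U \<in> zigzag_ring m \<Longrightarrow> U \<subseteq> {1..m} \<times> X_set m"
  unfolding zigzag_ring_mem by (elim conjE)

lemma zigzag_level_0:
  "U \<in> zigzag_ring m \<Longrightarrow> (k, 0) \<in> U \<Longrightarrow> l \<in> {1..m} \<Longrightarrow> (l, 0) \<in> U"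
  unfolding zigzag_ring_mem by metis

lemma zigzag_edge:
  "U \<in> zigzag_ring m \<Longrightarrow> (k, h) \<in> U \<Longrightarrow> 1 \<le> h \<Longrightarrow> h \<le> k \<Longrightarrow> even (k + h) \<Longrightarrow>
     l \<in> {1..m} \<Longrightarrow> l = Suc k \<or> k = Suc l \<Longrightarrow> (l, h) \<in> U"
  unfolding zigzag_ring_mem by metis

lemma zigzag_ringI:
  assumes "U \<subseteq> {1..m} \<times> X_set m"
    and "\<And>k l. (k, 0) \<in> U \<Longrightarrow> l \<in> {1..m} \<Longrightarrow> (l, 0) \<in> U"
    and "\<And>k h l. (k, h) \<in> U \<Longrightarrow> 1 \<le> h \<Longrightarrow> h \<le> k \<Longrightarrow> even (k + h) \<Longrightarrow>
      l \<in> {1..m} \<Longrightarrow> l = Suc k \<or> k = Suc l \<Longrightarrow> (l, h) \<in> U"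
  shows "U \<in> zigzag_ring m"
  unfolding zigzag_ring_mem by (intro conjI allI impI; (elim conjE)?) (fact assms)+

text \<open>Lowering the level by one maps an edge at level \<open>h > 1\<close> to a reversed edge, because the
  parity of \<open>k + h\<close> changes, and the ends of an edge at level \<open>1\<close> to identified points.\<close>

lemma zigzag_F:
  assumes U: "U \<in> zigzag_ring m"
  shows "F_set {1..m} m U \<in> zigzag_ring m"
proof (rule zigzag_ringI)
  show "F_set {1..m} m U \<subseteq> {1..m} \<times> X_set m"
    by (auto simp: F_set_mem)
  show "(l, 0) \<in> F_set {1..m} m U" if "(k, 0) \<in> F_set {1..m} m U" "l \<in> {1..m}" for k l
    using that zigzag_level_0[OF U, of l k] by (auto simp: F_set_mem sigma_def)
  fix k h l
  assume *: "(k, h) \<in> F_set {1..m} m U" "1 \<le> h" "h \<le> k" "even (k + h)" "l \<in> {1..m}"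
    "l = Suc k \<or> k = Suc l"
  have "(l, h - 1) \<notin> U"
  proof
    assume l: "(l, h - 1) \<in> U"
    have k: "k \<in> {1..m}" "(k, h - 1) \<notin> U"
      using *(1) by (auto simp: F_set_mem sigma_def)
    show False
    proof (cases "h = 1")
      case True
      then show False using l k zigzag_level_0[OF U, of l k] by simp
    next
      case False
      then have "1 \<le> h - 1" "h - 1 \<le> l" "even (l + (h - 1))" "k = Suc l \<or> l = Suc k"
        using *(2,3,4,6) by auto
      from zigzag_edge[OF U l this(1,2,3) k(1) this(4)] k(2) show False by simp
    qed
  qed
  then show "(l, h) \<in> F_set {1..m} m U"
    using *(1,5) by (auto simp: F_set_mem sigma_def)
qed

lemma zigzag_E:
  assumes U: "U \<in> zigzag_ring m"
  shows "E_set {1..m} m g U \<in> zigzag_ring m"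
proof (rule zigzag_ringI)
  show "E_set {1..m} m g U \<subseteq> {1..m} \<times> X_set m"
    by (auto simp: E_set_mem)
  show "(l, 0) \<in> E_set {1..m} m g U" if "(k, 0) \<in> E_set {1..m} m g U" "l \<in> {1..m}" for k l
    using that zigzag_level_0[OF U, of k l] by (auto simp: E_set_mem tau_def)
  fix k h l
  assume *: "(k, h) \<in> E_set {1..m} m g U" "1 \<le> h" "h \<le> k" "even (k + h)" "l \<in> {1..m}"
    "l = Suc k \<or> k = Suc l"
  then have "(k, tau g h) \<in> U" "h \<in> X_set m"
    by (auto simp: E_set_mem)
  then have "(l, tau g h) \<in> U"
    using zigzag_level_0[OF U, of k l] zigzag_edge[OF U, of k h l] *(2-) by (auto simp: tau_def)
  then show "(l, h) \<in> E_set {1..m} m g U"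
    using \<open>h \<in> X_set m\<close> *(5) by (simp add: E_set_mem)
qed

lemma set_ring_zigzag: "set_ring {1..m} m (zigzag_ring m)"
proof
  show "zigzag_ring m \<subseteq> Pow ({1..m} \<times> X_set m)"
    using zigzag_ring_sub by blast
  show "{} \<in> zigzag_ring m" "{1..m} \<times> X_set m \<in> zigzag_ring m"
    by (rule zigzag_ringI; auto simp: X_set_def)+
  show "F_set {1..m} m U \<in> zigzag_ring m" if "U \<in> zigzag_ring m" for U
    using that by (rule zigzag_F)
  show "E_set {1..m} m g U \<in> zigzag_ring m" if "U \<in> zigzag_ring m" for U g
    using that by (rule zigzag_E)
  fix U V assume U: "U \<in> zigzag_ring m" and V: "V \<in> zigzag_ring m"
  note sub = zigzag_ring_sub[OF U] zigzag_ring_sub[OF V]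
  show "U \<union> V \<in> zigzag_ring m"
    by (rule zigzag_ringI) (use sub zigzag_level_0[OF U] zigzag_level_0[OF V]
      zigzag_edge[OF U] zigzag_edge[OF V] in \<open>(metis Un_iff Un_least)+\<close>)
  show "U \<inter> V \<in> zigzag_ring m"
    by (rule zigzag_ringI) (use sub zigzag_level_0[OF U] zigzag_level_0[OF V]
      zigzag_edge[OF U] zigzag_edge[OF V] in \<open>(metis Int_iff le_infI1)+\<close>)
qed

lemma seed_mem: "seed m \<in> zigzag_ring m"
  by (rule zigzag_ringI) (auto simp: seed_def X_set_def)

lemma upset_mem: "1 \<le> g \<Longrightarrow> upset m g \<in> zigzag_ring m"
  by (rule zigzag_ringI) (auto simp: upset_def)

context
  fixes m :: nat
begin

interpretation zigzag: set_ring "{1..m}" m "zigzag_ring m"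
  by (rule set_ring_zigzag)

text \<open>If \<open>y\<close> contains \<open>(n + 1, n + 1)\<close>, then \<open>F_set {1..m} m y\<close> omits
  \<open>(n + 1, n + 2)\<close>, and \<open>F_set {1..m} m (seed m)\<close> omits \<open>(n + 2, n + 2)\<close>; what remains
  of the principal upset of \<open>(n + 2, n + 2)\<close> lies in the seed.\<close>

lemma diagonal_reached:
  "Suc n \<le> m \<Longrightarrow> \<exists>y\<in>(zigzag.ded ^^ n) {seed m}. (Suc n, Suc n) \<in> y"
proof (induction n)
  case 0
  then show ?case by (simp add: seed_def X_set_def)
next
  case (Suc n)
  have K: "{seed m} \<subseteq> zigzag_ring m"
    using seed_mem by simp
  obtain y where y: "y \<in> (zigzag.ded ^^ n) {seed m}" "(Suc n, Suc n) \<in> y"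
    using Suc by auto
  have seed: "seed m \<in> (zigzag.ded ^^ n) {seed m}"
    using zigzag.iter_mono[OF K, of 0 n] by simp
  let ?t = "F_set {1..m} m y \<inter> F_set {1..m} m (seed m)"
  have "?t \<in> odd_terms {1..m} m ((zigzag.ded ^^ n) {seed m})"
    using y(1) seed by (intro odd_Int odd_F even_gen)
  moreover have "upset m (Suc (Suc n)) \<inter> ?t \<subseteq> seed m"
    using y(2) Suc.prems by (auto simp: upset_def F_set_mem sigma_def seed_def X_set_def)
  moreover have "upset m (Suc (Suc n)) \<in> zigzag_ring m"
    by (rule upset_mem) simp
  ultimately have "upset m (Suc (Suc n)) \<in> (zigzag.ded ^^ Suc n) {seed m}"
    unfolding zigzag.iter_Suc[OF K] by blast
  moreover have "(Suc (Suc n), Suc (Suc n)) \<in> upset m (Suc (Suc n))"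
    using Suc.prems by (simp add: upset_def X_set_def)
  ultimately show ?case by blast
qed

text \<open>A point lies in all odd terms over \<open>Y\<close> if no composite of the maps \<open>sigma\<close> and
  \<open>tau j\<close> with an odd number of \<open>sigma\<close> moves its level to one at which its column meets
  an element of \<open>Y\<close>. Here \<open>Y\<close> does not meet column \<open>k\<close> at level \<open>0\<close> or below
  level \<open>k - 1\<close>, and for \<open>k \<ge> n + 2\<close> not at level \<open>k\<close> either.\<close>

lemma zigzag_terms:
  assumes Y: "Y \<subseteq> zigzag_ring m"
    and below: "\<And>y k h. y \<in> Y \<Longrightarrow> (k, h) \<in> y \<Longrightarrow> h < k \<Longrightarrow> (k, h) \<in> seed m"
    and diag: "\<And>y k. y \<in> Y \<Longrightarrow> n + 2 \<le> k \<Longrightarrow> (k, k) \<notin> y"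
  shows "t \<in> odd_terms {1..m} m Y \<Longrightarrow> (k, h) \<in> {1..m} \<times> X_set m \<Longrightarrow>
      h < k \<or> h = Suc k \<and> n + 2 \<le> k \<Longrightarrow> (k, h) \<in> t"
proof -
  let ?P = "\<lambda>s. \<forall>k h. (Suc h < k \<or> h = 0 \<or> h = k \<and> n + 2 \<le> k) \<longrightarrow> (k, h) \<notin> s"
  let ?Q = "\<lambda>t. \<forall>k h. (k, h) \<in> {1..m} \<times> X_set m \<and>
    (h < k \<or> h = Suc k \<and> n + 2 \<le> k) \<longrightarrow> (k, h) \<in> t"
  have "(s \<in> even_terms {1..m} m Y \<longrightarrow> ?P s) \<and> (t \<in> odd_terms {1..m} m Y \<longrightarrow> ?Q t)" for s t
  proof (rule even_terms_odd_terms.induct)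
    fix y assume y: "y \<in> Y"
    show "?P y"
    proof (intro allI impI notI)
      fix k h assume *: "Suc h < k \<or> h = 0 \<or> h = k \<and> n + 2 \<le> k" "(k, h) \<in> y"
      have "1 \<le> k" using *(2) y Y zigzag_ring_sub by fastforce
      then show False
        using below[OF y *(2)] diag[OF y, of k] * by (auto simp: seed_def)
    qed
  next
    fix x assume x: "?Q x"
    show "?P (F_set {1..m} m x)"
    proof (intro allI impI notI)
      fix k h assume *: "Suc h < k \<or> h = 0 \<or> h = k \<and> n + 2 \<le> k" "(k, h) \<in> F_set {1..m} m x"
      then have "(k, sigma h) \<in> {1..m} \<times> X_set m" "sigma h < k"
        by (auto simp: F_set_mem sigma_def X_set_def)
      then show False
        using x *(2) by (auto simp: F_set_mem)
    qed
  next
    fix x assume x: "?P x"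
    show "?Q (F_set {1..m} m x)"
    proof (intro allI impI)
      fix k h assume *: "(k, h) \<in> {1..m} \<times> X_set m \<and> (h < k \<or> h = Suc k \<and> n + 2 \<le> k)"
      then have "Suc (sigma h) < k \<or> sigma h = 0 \<or> sigma h = k \<and> n + 2 \<le> k"
        by (auto simp: sigma_def)
      then show "(k, h) \<in> F_set {1..m} m x"
        using x * by (auto simp: F_set_mem)
    qed
  next
    fix x g assume x: "?P x"
    show "?P (E_set {1..m} m g x)"
      using x by (simp add: E_set_mem tau_def)
  next
    fix x g assume x: "?Q x"
    show "?Q (E_set {1..m} m g x)"
      using x by (simp add: E_set_mem tau_def X_set_def)
  next
    fix x y assume "?P x" "?P y"
    then show "?P (x \<union> y)" by simp
  next
    fix x y assume "?Q x" "?Q y"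
    then show "?Q (x \<inter> y)" by simp
  qed simp_all
  then show "t \<in> odd_terms {1..m} m Y \<Longrightarrow> (k, h) \<in> {1..m} \<times> X_set m \<Longrightarrow>
      h < k \<or> h = Suc k \<and> n + 2 \<le> k \<Longrightarrow> (k, h) \<in> t"
    by blast
qed

lemma diagonal_not_reached:
  assumes "x \<in> (zigzag.ded ^^ n) {seed m}" and "n + 2 \<le> k"
  shows "(k, k) \<notin> x"
proof -
  have K: "{seed m} \<subseteq> zigzag_ring m"
    using seed_mem by simp
  \<comment> \<open>Two further properties carry the induction: below the diagonal nothing beyond the seed is
    ever reached, and the point \<open>(k, k + 1)\<close>, which lies above \<open>(k + 1, k + 1)\<close>, is
    not reached while \<open>(k, k)\<close> is not.\<close>
  have "(\<forall>k h. (k, h) \<in> x \<and> h < k \<longrightarrow> (k, h) \<in> seed m) \<and>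
      (\<forall>k. n + 2 \<le> k \<longrightarrow> (k, k) \<notin> x \<and> (k, Suc k) \<notin> x)"
    using assms(1)
  proof (induction n arbitrary: x)
    case 0
    then show ?case by (auto simp: seed_def)
  next
    case (Suc n)
    let ?Y = "(zigzag.ded ^^ n) {seed m}"
    from Suc.prems obtain t where x: "x \<in> zigzag_ring m" "t \<in> odd_terms {1..m} m ?Y"
      "x \<inter> t \<subseteq> seed m"
      unfolding zigzag.iter_Suc[OF K] by blast
    have t: "(k, h) \<in> t" if "(k, h) \<in> x" "h < k \<or> h = Suc k \<and> n + 2 \<le> k" for k h
    proof (rule zigzag_terms[OF zigzag.iter_sub[OF K] _ _ x(2)])
      show "(k, h) \<in> {1..m} \<times> X_set m"
        using that(1) x(1) zigzag_ring_sub by blast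
    qed (use Suc.IH that(2) in blast)+
    have seed: "(k, h) \<in> seed m" if "(k, h) \<in> x" "h < k \<or> h = Suc k \<and> n + 2 \<le> k" for k h
      using t[OF that] that(1) x(3) by blast
    have top: "(k, Suc k) \<notin> x" if "n + 2 \<le> k" for k
      using seed[of k "Suc k"] that by (auto simp: seed_def)
    have "(k, k) \<notin> x" if k: "Suc n + 2 \<le> k" for k
    proof
      assume kk: "(k, k) \<in> x"
      obtain l where l: "k = Suc l" "n + 2 \<le> l"
        using k by (cases k) auto
      have "(k, k) \<in> {1..m} \<times> X_set m"
        using kk x(1) zigzag_ring_sub by blast
      then have "l \<in> {1..m}" using l by auto
      then have "(l, k) \<in> x"
        using zigzag_edge[OF x(1) kk, of l] l by simp
      then show False
        using top[OF l(2)] l(1) by simp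
    qed
    then show ?case
      using seed top by (metis Suc_leD add_Suc)
  qed
  then show ?thesis
    using assms(2) by blast
qed

lemma zigzag_iter_neq:
  assumes "n + 2 \<le> m"
  shows "(zigzag.ded ^^ n) {seed m} \<noteq> (zigzag.ded ^^ Suc n) {seed m}"
proof -
  obtain y where "y \<in> (zigzag.ded ^^ Suc n) {seed m}" "(Suc (Suc n), Suc (Suc n)) \<in> y"
    using diagonal_reached[of "Suc n"] assms by auto
  then show ?thesis
    using diagonal_not_reached[of y n "Suc (Suc n)"] by auto
qed

end

section \<open>The ranks\<close>

lemma rank_eqI:
  assumes "stable_at D V k" and "\<And>n. n < k \<Longrightarrow> \<not> stable_at D V n"
  shows "rank D V = enat k"
proof -
  have "(LEAST n. stable_at D V n) = k"
    using assms by (intro Least_equality) (auto simp: not_less[symmetric])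
  then show ?thesis using assms(1) by (auto simp: rank_def)
qed

text \<open>The zigzag ring is finite, so it has an isomorphic copy on any infinite type, and its
  finitely many columns can be numbered by elements of any infinite type.\<close>

lemma zigzag_in_HSP:
  assumes a: "infinite (UNIV :: 'a set)" and i: "infinite (UNIV :: 'i set)"
  obtains A :: "(opsym, 'a) alg" and h where
    "ring_image {1..m} m (zigzag_ring m) A h" "inj_on h (zigzag_ring m)"
    "A \<in> HSP TYPE('i) (sig_A m) {alg_A m}"
proof -
  have "finite (zigzag_ring m)"
    by (rule finite_subset[OF set_ring.sub[OF set_ring_zigzag]]) (simp add: X_set_def)
  then obtain g :: "(nat \<times> nat) set \<Rightarrow> nat" where g: "inj_on g (zigzag_ring m)"
    using finite_imp_inj_to_nat_seg by metis
  obtain b :: "nat \<Rightarrow> 'a" where b: "inj b"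
    using infinite_countable_subset[OF a] by blast
  obtain u :: "nat \<Rightarrow> 'i" where u: "inj u"
    using infinite_countable_subset[OF i] by blast
  have inj: "inj_on (b \<circ> g) (zigzag_ring m)"
    by (rule comp_inj_on[OF g inj_on_subset[OF b subset_UNIV]])
  obtain A where A: "ring_image {1..m} m (zigzag_ring m) A (b \<circ> g)"
    using set_ring.isomorphic_copy[OF set_ring_zigzag inj] by (elim exE)
  have "inv u ` u ` {1..m} = {1..m}"
    using u by (simp add: image_image)
  from ring_image_imp_HSP[OF A this] show thesis
    by (rule that[OF A inj])
qed

lemma deductive_rank_HSP:
  assumes m: "m \<ge> 2" and inf: "infinite (UNIV :: 'a set)" "infinite (UNIV :: 'i set)"
  shows "deductive_rank (sig_A m) Bot (HSP TYPE('i) (sig_A m) {alg_A m} :: (opsym, 'a) alg set)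
    = enat (m - 1)"
  unfolding deductive_rank_def
proof (rule rank_eqI)
  let ?V = "HSP TYPE('i) (sig_A m) {alg_A m} :: (opsym, 'a) alg set"
  show "stable_at (ded_op (sig_A m) Bot) ?V (m - 1)"
    unfolding stable_at_def
  proof (intro ballI allI impI, elim conjE)
    fix A :: "(opsym, 'a) alg" and I
    assume "A \<in> ?V" and I: "I \<subseteq> carrier A"
    then obtain J :: "'i set" and C h where "ring_image J m C A h"
      using HSP_imp_ring_image by blast
    then interpret ring_image J m C A h .
    have "(ded ^^ (m - 1)) (pullback I) = (ded ^^ (m - 1 + 1)) (pullback I)"
      using iter_mono[OF pullback_sub, of "m - 1" "m - 1 + 1" I]
        iter_stable[OF pullback_sub m, of "m - 1 + 1" I] by auto
    then show "(ded_op (sig_A m) Bot A ^^ (m - 1)) I = (ded_op (sig_A m) Bot A ^^ (m - 1 + 1)) I"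
      unfolding ded_iter_image[OF I] by simp
  qed
  fix n assume n: "n < m - 1"
  show "\<not> stable_at (ded_op (sig_A m) Bot) ?V n"
  proof
    assume stable: "stable_at (ded_op (sig_A m) Bot) ?V n"
    obtain A :: "(opsym, 'a) alg" and h where A: "ring_image {1..m} m (zigzag_ring m) A h"
      "inj_on h (zigzag_ring m)" "A \<in> ?V"
      using zigzag_in_HSP[OF inf] by metis
    interpret ring_image "{1..m}" m "zigzag_ring m" A h by (rule A(1))
    have I: "{h (seed m)} \<subseteq> carrier A"
      using seed_mem h_onto by blast
    have pb: "pullback {h (seed m)} = {seed m}"
      using A(2) seed_mem by (auto simp: pullback_def inj_on_eq_iff)
    have "(ded_op (sig_A m) Bot A ^^ n) {h (seed m)} = (ded_op (sig_A m) Bot A ^^ (n + 1)) {h (seed m)}"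
      using stable A(3) I unfolding stable_at_def by blast
    then have "(ded ^^ n) {seed m} = (ded ^^ Suc n) {seed m}"
      using pullback_ded_iter[OF I, of n] pullback_ded_iter[OF I, of "Suc n"] pb by simp
    moreover have "n + 2 \<le> m"
      using n by simp
    ultimately show False
      using zigzag_iter_neq by metis
  qed
qed

lemma inductive_rank_HSP:
  assumes m: "m \<ge> 2" and inf: "infinite (UNIV :: 'a set)" "infinite (UNIV :: 'i set)"
  shows "inductive_rank (sig_A m) Bot (HSP TYPE('i) (sig_A m) {alg_A m} :: (opsym, 'a) alg set)
    = enat 1"
  unfolding inductive_rank_def
proof (rule rank_eqI)
  let ?V = "HSP TYPE('i) (sig_A m) {alg_A m} :: (opsym, 'a) alg set"
  show "stable_at (ind_op (sig_A m) Bot) ?V 1"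
    unfolding stable_at_def
  proof (intro ballI allI impI, elim conjE)
    fix A :: "(opsym, 'a) alg" and I
    assume "A \<in> ?V" and I: "I \<subseteq> carrier A"
    then obtain J :: "'i set" and C h where "ring_image J m C A h"
      using HSP_imp_ring_image by blast
    then interpret ring_image J m C A h .
    show "(ind_op (sig_A m) Bot A ^^ 1) I = (ind_op (sig_A m) Bot A ^^ (1 + 1)) I"
      using ind_op_idem[OF I] by simp
  qed
  fix n :: nat assume "n < 1"
  then have n: "n = 0" by simp
  show "\<not> stable_at (ind_op (sig_A m) Bot) ?V n"
  proof
    assume stable: "stable_at (ind_op (sig_A m) Bot) ?V n"
    obtain A :: "(opsym, 'a) alg" and h where A: "ring_image {1..m} m (zigzag_ring m) A h"
      "inj_on h (zigzag_ring m)" "A \<in> ?V"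
      using zigzag_in_HSP[OF inf] by metis
    interpret ring_image "{1..m}" m "zigzag_ring m" A h by (rule A(1))
    let ?T = "{1..m} \<times> X_set m"
    have I: "{h ?T} \<subseteq> carrier A"
      using top_mem h_onto by blast
    have T: "?T \<in> pullback {h ?T}"
      unfolding pullback_def using top_mem by blast
    then have "F_set {1..m} m ?T \<in> odd_terms {1..m} m (pullback {h ?T})"
      by (intro odd_F even_gen)
    then have "{} \<in> odd_terms {1..m} m (pullback {h ?T})"
      by (simp only: F_top)
    then have "{} \<in> ind_op (sig_A m) Bot (ring_alg {1..m} m (zigzag_ring m)) (pullback {h ?T})"
      unfolding ind_op_ring[OF pullback_sub]
      by (intro CollectI conjI empty_mem bexI[OF _ even_bot] bexI[OF bexI T]) simp_all
    then have "h {} \<in> ind_op (sig_A m) Bot A {h ?T}"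
      unfolding ind_op_image[OF I] by blast
    moreover have "ind_op (sig_A m) Bot A {h ?T} = {h ?T}"
      using stable A(3) I unfolding stable_at_def n by auto
    ultimately have "h {} = h ?T" by simp
    then have "{} = ?T"
      using A(2) by (simp only: inj_on_eq_iff empty_mem top_mem)
    moreover have "(1, 0) \<in> ?T"
      using m by (simp add: X_set_def)
    ultimately show False
      by (metis empty_iff)
  qed
qed

theorem theorem3p10:
  assumes "infinite (UNIV :: 'a set)" and "infinite (UNIV :: 'i set)"
  shows "(\<forall>m\<ge>2. rank_pair (sig_A m) Bot
             (HSP TYPE('i) (sig_A m) {alg_A m} :: (opsym, 'a) alg set) = (1, enat (m - 1)))
       \<and> (\<forall>d\<ge>1. \<exists>(\<Sigma> :: opsym signature) c (B :: (opsym, nat set) alg).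
             \<Sigma> c = Some 0 \<and> algebra \<Sigma> B \<and> finite (carrier B) \<and>
             rank_pair \<Sigma> c (HSP TYPE('i) \<Sigma> {B} :: (opsym, 'a) alg set) = (1, enat d))"
proof -
  have *: "rank_pair (sig_A m) Bot
      (HSP TYPE('i) (sig_A m) {alg_A m} :: (opsym, 'a) alg set) = (1, enat (m - 1))" if "m \<ge> 2" for m
    unfolding rank_pair_def inductive_rank_HSP[OF that assms] deductive_rank_HSP[OF that assms]
    by (simp add: one_enat_def)
  moreover have "\<exists>(\<Sigma> :: opsym signature) c (B :: (opsym, nat set) alg).
      \<Sigma> c = Some 0 \<and> algebra \<Sigma> B \<and> finite (carrier B) \<and>
      rank_pair \<Sigma> c (HSP TYPE('i) \<Sigma> {B} :: (opsym, 'a) alg set) = (1, enat d)" if "d \<ge> 1" for d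
  proof (intro exI conjI)
    show "sig_A (d + 1) Bot = Some 0" by simp
    show "algebra (sig_A (d + 1)) (alg_A (d + 1))" by (rule algebra_alg_A)
    show "finite (carrier (alg_A (d + 1)))" by (simp add: alg_A_def X_set_def)
    show "rank_pair (sig_A (d + 1)) Bot
        (HSP TYPE('i) (sig_A (d + 1)) {alg_A (d + 1)} :: (opsym, 'a) alg set) = (1, enat d)"
      using *[of "d + 1"] that by simp
  qed
  ultimately show ?thesis by blast
qed

end
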